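(* Let $d_n=n+1$ for all $n\ge 1$, let $(k_n)_{n\geq 1}$ be a strictly increasing sequence of positive integers with $k_n\ge 2d_n$ for all $n$, and let $G=\langle s,t\rangle$ be the associated group defined in the context. Then $G$ is a finitely generated $3$-step solvable group (that is, solvable of derived length $3$) with the following properties: (1) $G$ is torsion-free; (2) $G$ contains a normal subgroup that is free abelian of infinite rank; (3) every finitely generated torsion-free metabelian subquotient of $G$ is virtually abelian.
   Context: A group $Q$ is a subquotient of $G$ if there are subgroups $K,H$ of $G$ with $K\lhd H$ and $Q\simeq H/K$. A group is metabelian if its derived subgroup is abelian. Construction of $G$. Let $C_k=\mathbb{Z}/k\mathbb{Z}$ and let $D=\langle a,b\mid a^2=b^2=1\rangle$ be the infinite dihedral group. Let $(d_n)_{n\ge1}$ and $(k_n)_{n\ge 1}$ be strictly increasing sequences of positive integers with $d_1>1$ and $k_n\ge 2d_n$ for all $n$. For $n\ge1$ let $H_n=D^{k_n}\rtimes C_{k_n}$, where $C_{k_n}$ acts on $D^{k_n}$ by cyclic permutation of the factors; the coordinates of $D^{k_n}$ are indexed by $\{1,\dots,k_n\}$, taken modulo $k_n$, and the generator $1\in C_{k_n}$ acts by $f\mapsto (j\mapsto f(j-1))$. Let $\Delta=\mathbb{Z}\times\prod_{n\ge1}H_n$, with projections $\pi_0:\Delta\to\mathbb{Z}$ and $\pi_n:\Delta\to H_n$ for $n\ge1$. Let $\sigma_0$ be a generator of the factor $\mathbb{Z}$, and for $n\geq 1$ let $\sigma_n\in D^{k_n}\le H_n$ be defined by $\sigma_n(1)=a$,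 $\sigma_n(d_n)=b$, and $\sigma_n(j)=\mathrm{id}$ for $j\ne 1,d_n$. Let $s\in\Delta$ be the element with $\pi_0(s)=\sigma_0$ and $\pi_n(s)=\sigma_n$ for all $n\ge1$. Let $t\in\Delta$ be the element with $\pi_0(t)=0$ and $\pi_n(t)$ equal to the generator $1$ of $C_{k_n}$ for all $n\ge1$. Then $G$ is the subgroup of $\Delta$ generated by $s$ and $t$. *)

theory Defs
  imports "HOL-Algebra.Algebra"
begin

section \<open>General notions for groups\<close>

definition finitely_generated :: "('a, 'm) monoid_scheme \<Rightarrow> bool" where
  "finitely_generated G \<longleftrightarrow> (\<exists>S. finite S \<and> S \<subseteq> carrier G \<and> generate G S = carrier G)"

text \<open>Only meaningful for solvable groups: otherwise the set of admissible \<open>n\<close> is empty.\<close>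

definition derived_length :: "('a, 'm) monoid_scheme \<Rightarrow> nat" where
  "derived_length G = (LEAST n. (derived G ^^ n) (carrier G) = {\<one>\<^bsub>G\<^esub>})"

definition torsion_free :: "('a, 'm) monoid_scheme \<Rightarrow> bool" where
  "torsion_free G \<longleftrightarrow>
     (\<forall>x\<in>carrier G. \<forall>n::nat. n > 0 \<longrightarrow> x [^]\<^bsub>G\<^esub> n = \<one>\<^bsub>G\<^esub> \<longrightarrow> x = \<one>\<^bsub>G\<^esub>)"

definition abelian_subgroup :: "('a, 'm) monoid_scheme \<Rightarrow> 'a set \<Rightarrow> bool" where
  "abelian_subgroup G A \<longleftrightarrow> subgroup A G \<and> comm_group (G\<lparr>carrier := A\<rparr>)"

definition metabelian :: "('a, 'm) monoid_scheme \<Rightarrow> bool" where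
  "metabelian G \<longleftrightarrow> abelian_subgroup G (derived G (carrier G))"

definition virtually_abelian :: "('a, 'm) monoid_scheme \<Rightarrow> bool" where
  "virtually_abelian G \<longleftrightarrow> (\<exists>A. abelian_subgroup G A \<and> finite (rcosets\<^bsub>G\<^esub> A))"

text \<open>Taking the index set of the basis in the element type of \<open>G\<close> is no restriction, since a
  basis of \<open>G\<close> consists of elements of \<open>G\<close>.\<close>

definition free_abelian_of_infinite_rank :: "('a, 'm) monoid_scheme \<Rightarrow> bool" where
  "free_abelian_of_infinite_rank G \<longleftrightarrow>
     (\<exists>S :: 'a set. infinite S \<and> G \<cong> free_Abelian_group S)"

definition subquotient :: "('q, 'n) monoid_scheme \<Rightarrow> ('a, 'm) monoid_scheme \<Rightarrow> bool" where
  "subquotient Q G \<longleftrightarrow> group Q \<and>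
     (\<exists>H K. subgroup H G \<and> K \<lhd> (G\<lparr>carrier := H\<rparr>) \<and> Q \<cong> (G\<lparr>carrier := H\<rparr> Mod K))"

definition semidirect_product ::
  "('a, 'm) monoid_scheme \<Rightarrow> ('b, 'n) monoid_scheme \<Rightarrow> ('b \<Rightarrow> 'a \<Rightarrow> 'a) \<Rightarrow> ('a \<times> 'b) monoid" where
  "semidirect_product N Q \<phi> =
     \<lparr>carrier = carrier N \<times> carrier Q,
      monoid.mult = (\<lambda>(f, x) (g, y). (f \<otimes>\<^bsub>N\<^esub> \<phi> x g, x \<otimes>\<^bsub>Q\<^esub> y)),
      one = (\<one>\<^bsub>N\<^esub>, \<one>\<^bsub>Q\<^esub>)\<rparr>"


section \<open>Group presentations and the infinite dihedral group\<close>

text \<open>Words in the elements of the type \<open>'x\<close> and their formal inverses: the letter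
  \<open>(x, True)\<close> stands for \<open>x\<close> and \<open>(x, False)\<close> for the inverse of \<open>x\<close>.\<close>

type_synonym 'x word = "('x \<times> bool) list"

inductive pres_eq :: "'x word set \<Rightarrow> 'x word \<Rightarrow> 'x word \<Rightarrow> bool" for R where
  refl: "pres_eq R u u"
| sym: "pres_eq R u v \<Longrightarrow> pres_eq R v u"
| trans: "pres_eq R u v \<Longrightarrow> pres_eq R v w \<Longrightarrow> pres_eq R u w"
| cancel: "pres_eq R (u @ [(x, e), (x, \<not> e)] @ v) (u @ v)"
| relator: "r \<in> R \<Longrightarrow> pres_eq R (u @ r @ v) (u @ v)"

definition word_class :: "'x word set \<Rightarrow> 'x word \<Rightarrow> 'x word set" where
  "word_class R u = {v. pres_eq R u v}"

text \<open>The group with presentation \<open>\<langle>X | R\<rangle>\<close>, where \<open>X\<close> consists of all elements of type \<open>'x\<close>.\<close>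

definition presented_group :: "'x word set \<Rightarrow> 'x word set monoid" where
  "presented_group R =
     \<lparr>carrier = range (word_class R),
      monoid.mult = (\<lambda>U V. \<Union>u\<in>U. \<Union>v\<in>V. word_class R (u @ v)),
      one = word_class R []\<rparr>"

datatype dgen = A | B

abbreviation dihedral_relators :: "dgen word set" where
  "dihedral_relators \<equiv> {[(A, True), (A, True)], [(B, True), (B, True)]}"

type_synonym dihedral = "dgen word set"

definition Dinf :: "dihedral monoid" where
  "Dinf = presented_group dihedral_relators"

definition gen_a :: dihedral where
  "gen_a = word_class dihedral_relators [(A, True)]"

definition gen_b :: dihedral where
  "gen_b = word_class dihedral_relators [(B, True)]"


section \<open>The construction\<close>

text \<open>The coordinate index \<open>j - x\<close> is reduced modulo \<open>k\<close> to its representative in \<open>{1..k}\<close>.\<close>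

definition cyclic_shift :: "nat \<Rightarrow> int \<Rightarrow> (int \<Rightarrow> dihedral) \<Rightarrow> int \<Rightarrow> dihedral" where
  "cyclic_shift k x f = (\<lambda>j\<in>{1..int k}. f ((j - x - 1) mod int k + 1))"

definition H_group :: "nat \<Rightarrow> ((int \<Rightarrow> dihedral) \<times> int) monoid" where
  "H_group k =
     semidirect_product (product_group {1..int k} (\<lambda>_. Dinf)) (integer_mod_group k) (cyclic_shift k)"

definition sigma :: "nat \<Rightarrow> nat \<Rightarrow> int \<Rightarrow> dihedral" where
  "sigma k d =
     (\<lambda>j\<in>{1..int k}. if j = 1 then gen_a else if j = int d then gen_b else \<one>\<^bsub>Dinf\<^esub>)"

type_synonym ambient = "int \<times> (nat \<Rightarrow> (int \<Rightarrow> dihedral) \<times> int)"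

definition Delta :: "(nat \<Rightarrow> nat) \<Rightarrow> ambient monoid" where
  "Delta k = integer_group \<times>\<times> product_group {1..} (\<lambda>n. H_group (k n))"

definition elem_s :: "int \<Rightarrow> (nat \<Rightarrow> nat) \<Rightarrow> (nat \<Rightarrow> nat) \<Rightarrow> ambient" where
  "elem_s \<sigma>\<^sub>0 d k = (\<sigma>\<^sub>0, \<lambda>n\<in>{1..}. (sigma (k n) (d n), 0))"

definition elem_t :: "(nat \<Rightarrow> nat) \<Rightarrow> ambient" where
  "elem_t k = (0, \<lambda>n\<in>{1..}. (\<one>\<^bsub>product_group {1..int (k n)} (\<lambda>_. Dinf)\<^esub>, 1))"

text \<open>The parameter \<open>\<sigma>\<^sub>0\<close> is the chosen generator of the factor of integers.\<close>

definition G_group :: "int \<Rightarrow> (nat \<Rightarrow> nat) \<Rightarrow> (nat \<Rightarrow> nat) \<Rightarrow> ambient monoid" where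
  "G_group \<sigma>\<^sub>0 d k = (Delta k)\<lparr>carrier := generate (Delta k) {elem_s \<sigma>\<^sub>0 d k, elem_t k}\<rparr>"

end

theory Submission
  imports Defs
begin

text \<open>
  Write \<open>\<Gamma>\<close> for the group generated by \<open>s\<close> and \<open>t\<close>, and call the exponent sum of \<open>t\<close> in a word
  its degree. The elements of degree zero form the base, a normal subgroup generated by the
  conjugates \<open>s\<^sub>i = t\<^sup>i s t\<^sup>-\<^sup>i\<close>. Number the coordinates of the \<open>n\<close>-th factor from \<open>0\<close> to \<open>k n - 1\<close> on
  a circle. There \<open>s\<^sub>i\<close> has the letter \<open>a\<close> at \<open>i\<close> and the letter \<open>b\<close> at \<open>i + n\<close>, and the circle is longer
  than \<open>2 n\<close>. All properties of \<open>\<Gamma>\<close> rest on when letters \<open>a\<close> and \<open>b\<close> meet in one coordinate.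

  For a fixed finite set of positions \<open>i\<close> they do not meet at high levels \<open>n\<close>. So every base element
  has all its coordinates of high level among \<open>1, a, b\<close>, and its square lives in finitely many levels
  and consists of translations there. Conjugation only rotates the circle and inverts translations,
  hence squares of base elements have finitely many conjugates
  (\<open>finite_conjugates_square\<close>).

  At the level \<open>n = q - p\<close> the letters of \<open>s\<^sub>p\<close> and \<open>s\<^sub>q\<close> do meet. If a torsion element involved some
  \<open>s\<^sub>i\<close> an odd number of times, take the smallest such \<open>p\<close> and the largest such \<open>q\<close>; they differ,
  because the integer component forces an even number of them. One coordinate of level \<open>q - p\<close> would
  then be a nontrivial translation, of infinite order (\<open>torsion_free_\<Gamma>\<close>). For the same reason the
  commutator of \<open>s\<^sub>i\<close> and \<open>s\<^sub>i\<^sub>+\<^sub>n\<close> is the translation \<open>(b a)\<^sup>2\<close> in one coordinate of level \<open>n\<close>, trivial at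
  higher levels, and again a product of powers of such translations below. By induction on the level
  \<open>\<Gamma>\<close> contains the whole direct sum of the groups \<open>\<langle>(b a)\<^sup>2\<rangle>\<close> over all coordinates
  (\<open>lattice_elem_in_\<Gamma>\<close>), which is normal and free abelian of infinite rank.

  The derived subgroup of \<open>\<Gamma>\<close> lies in the base, that of the base consists of commuting translations,
  and a computation at level \<open>1\<close> shows that the second derived subgroup is not trivial.

  Now let \<open>Q\<close> be a finitely generated torsion-free metabelian subquotient, and \<open>M\<close> the image of the base
  in it. Roots are unique in the torsion-free abelian group \<open>Q'\<close>, and squares of elements of \<open>Q'\<close> have
  finite conjugacy classes, so the elements of \<open>Q'\<close> have finite conjugacy classes, too. As \<open>Q\<close> is finitely
  generated, \<open>Q'\<close> is generated by finitely many such classes, and the centralizer \<open>C\<close> of \<open>Q'\<close> has finite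
  index. The group \<open>C\<close> is torsion-free and nilpotent of class at most two, so two of its elements commute
  as soon as nontrivial powers of them do. This makes \<open>M \<inter> C\<close> central in \<open>C\<close>. Since \<open>C / (M \<inter> C)\<close> has rank at
  most one, \<open>C\<close> is abelian
  (\<open>virtually_abelian_of_almost_central_by_rank_one\<close>).
\<close>

section \<open>A criterion for being virtually abelian\<close>

definition conjugates :: "('a, 'm) monoid_scheme \<Rightarrow> 'a \<Rightarrow> 'a set" where
  "conjugates G x = (\<lambda>g. g \<otimes>\<^bsub>G\<^esub> x \<otimes>\<^bsub>G\<^esub> inv\<^bsub>G\<^esub> g) ` carrier G"

text \<open>The situation of a group \<open>G\<close> with a homomorphism to the integers whose kernel is \<open>M\<close>, if squares of
  elements of \<open>M\<close> have only finitely many conjugates. That the image of \<open>G\<close> has rank at most one is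
  expressed by relations between pairs of elements, because this form passes to subgroups and to
  homomorphic images without a choice of generators.\<close>

definition almost_central_by_rank_one :: "('a, 'm) monoid_scheme \<Rightarrow> 'a set \<Rightarrow> bool" where
  "almost_central_by_rank_one G M \<longleftrightarrow> subgroup M G \<and>
     (\<forall>x\<in>carrier G. \<forall>y\<in>carrier G. x \<otimes>\<^bsub>G\<^esub> y \<otimes>\<^bsub>G\<^esub> inv\<^bsub>G\<^esub> x \<otimes>\<^bsub>G\<^esub> inv\<^bsub>G\<^esub> y \<in> M) \<and>
     (\<forall>x\<in>M. finite (conjugates G (x \<otimes>\<^bsub>G\<^esub> x))) \<and>
     (\<forall>x\<in>carrier G. \<forall>y\<in>carrier G. \<exists>(p::int) (q::int).
        (p \<noteq> 0 \<or> q \<noteq> 0) \<and> x [^]\<^bsub>G\<^esub> p \<otimes>\<^bsub>G\<^esub> y [^]\<^bsub>G\<^esub> q \<in> M)"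

context group
begin

lemma inv_cancel_left:
  assumes "x \<in> carrier G" "z \<in> carrier G"
  shows "x \<otimes> (inv x \<otimes> z) = z" "inv x \<otimes> (x \<otimes> z) = z"
  using assms by (simp_all add: m_assoc[symmetric])

text \<open>Together with the group axioms these rules reduce a group word to its freely reduced form.\<close>

lemmas free_reduce = m_assoc inv_cancel_left inv_mult_group

lemma conj_eq_iff_commute:
  assumes "x \<in> carrier G" "y \<in> carrier G"
  shows "y \<otimes> x \<otimes> inv y = x \<longleftrightarrow> x \<otimes> y = y \<otimes> x"
  using assms by (metis inv_solve_right m_closed inv_solve_right')

lemma commute_pow:
  assumes "x \<in> carrier G" "y \<in> carrier G" "x \<otimes> y = y \<otimes> x"
  shows "x [^] (n::nat) \<otimes> y = y \<otimes> x [^] n"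
proof (induction n)
  case (Suc n)
  have "x [^] Suc n \<otimes> y = x [^] n \<otimes> (y \<otimes> x)"
    using assms by (simp add: m_assoc)
  also have "\<dots> = (x [^] n \<otimes> y) \<otimes> x"
    using assms by (simp add: m_assoc)
  also have "\<dots> = y \<otimes> x [^] Suc n"
    unfolding Suc.IH using assms by (simp add: m_assoc)
  finally show ?case .
qed (use assms in simp)

lemma commute_inv:
  assumes "x \<in> carrier G" "y \<in> carrier G" "x \<otimes> y = y \<otimes> x"
  shows "inv x \<otimes> y = y \<otimes> inv x"
proof -
  have "inv x \<otimes> y = inv x \<otimes> (y \<otimes> x) \<otimes> inv x" using assms(1,2) by (simp add: m_assoc)
  also have "\<dots> = inv x \<otimes> (x \<otimes> y) \<otimes> inv x" by (simp only: assms(3))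
  also have "\<dots> = y \<otimes> inv x" using assms(1,2) by (simp add: free_reduce)
  finally show ?thesis .
qed

lemma commute_int_pow:
  assumes "x \<in> carrier G" "y \<in> carrier G" "x \<otimes> y = y \<otimes> x"
  shows "x [^] (n::int) \<otimes> y = y \<otimes> x [^] n"
proof (cases n rule: int_cases2)
  case (nonneg m)
  then show ?thesis using commute_pow[OF assms, of m] by (simp only: int_pow_int)
next
  case (nonpos m)
  have "inv (x [^] m) \<otimes> y = y \<otimes> inv (x [^] m)"
    by (intro commute_inv commute_pow nat_pow_closed assms)
  then show ?thesis using nonpos assms(1) by (simp only: int_pow_neg_int)
qed

lemma commute_mult:
  assumes "x \<in> carrier G" "y \<in> carrier G" "z \<in> carrier G"
    and "x \<otimes> z = z \<otimes> x" "y \<otimes> z = z \<otimes> y"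
  shows "(x \<otimes> y) \<otimes> z = z \<otimes> (x \<otimes> y)"
  by (metis assms m_assoc)

lemma conj_nat_pow:
  assumes "x \<in> carrier G" "y \<in> carrier G"
  shows "y \<otimes> x [^] (n::nat) \<otimes> inv y = (y \<otimes> x \<otimes> inv y) [^] n"
proof (induction n)
  case (Suc n)
  have "y \<otimes> x [^] Suc n \<otimes> inv y = (y \<otimes> x [^] n \<otimes> inv y) \<otimes> (y \<otimes> x \<otimes> inv y)"
    using assms by (simp add: free_reduce)
  then show ?case by (simp add: Suc.IH)
qed (use assms in simp)

lemma conj_int_pow:
  assumes "x \<in> carrier G" "y \<in> carrier G"
  shows "y \<otimes> x [^] (n::int) \<otimes> inv y = (y \<otimes> x \<otimes> inv y) [^] n"
proof (cases n rule: int_cases2)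
  case (nonneg m)
  then show ?thesis using conj_nat_pow[OF assms, of m] by (simp only: int_pow_int)
next
  case (nonpos m)
  have "y \<otimes> inv (x [^] m) \<otimes> inv y = inv (y \<otimes> x [^] m \<otimes> inv y)"
    using assms by (simp add: free_reduce)
  then show ?thesis using nonpos assms by (simp add: int_pow_neg_int conj_nat_pow)
qed

text \<open>Conjugation by \<open>y\<close> multiplies \<open>x\<close> by a factor \<open>c\<close>. If \<open>c\<close> commutes with \<open>x\<close>, then it multiplies \<open>x\<^sup>p\<close> by \<open>c\<^sup>p\<close>,
  and \<open>c\<^sup>p = 1\<close> forces \<open>c = 1\<close>. In a group of nilpotency class two the hypothesis on \<open>c\<close> always holds.\<close>

lemma commute_of_commute_int_pow:
  assumes tf: "torsion_free G" and x: "x \<in> carrier G" and y: "y \<in> carrier G"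
    and c: "x \<otimes> (inv x \<otimes> (y \<otimes> x \<otimes> inv y)) = (inv x \<otimes> (y \<otimes> x \<otimes> inv y)) \<otimes> x"
    and p: "p \<noteq> 0" "x [^] (p::int) \<otimes> y = y \<otimes> x [^] p"
  shows "x \<otimes> y = y \<otimes> x"
proof -
  define c where "c = inv x \<otimes> (y \<otimes> x \<otimes> inv y)"
  define z where "z = y \<otimes> x \<otimes> inv y"
  have cc: "c \<in> carrier G" "z \<in> carrier G" using x y by (simp_all add: c_def z_def)
  have z: "z = x \<otimes> c" using x y by (simp add: c_def z_def free_reduce)
  have xp: "x [^] p \<in> carrier G" using x by simp
  have "z [^] p = y \<otimes> x [^] p \<otimes> inv y"
    by (simp add: z_def conj_int_pow x y)
  also have "\<dots> = x [^] p" using p(2) conj_eq_iff_commute[OF xp y] by simp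
  finally have "z [^] p = x [^] p" .
  moreover have "z [^] p = x [^] p \<otimes> c [^] p"
    unfolding z by (rule int_pow_mult_distrib) (use c x cc in \<open>auto simp: c_def\<close>)
  ultimately have "x [^] p \<otimes> c [^] p = x [^] p" by simp
  then have cp: "c [^] p = \<one>" using xp cc by simp
  have "c [^] (nat \<bar>p\<bar>) = \<one>"
  proof (cases p rule: int_cases2)
    case (nonneg m)
    then show ?thesis using cp by (simp add: int_pow_int)
  next
    case (nonpos m)
    then show ?thesis using cp cc by (simp add: int_pow_neg_int)
  qed
  then have "c = \<one>"
    using tf p cc unfolding torsion_free_def by (metis zero_less_nat_eq zero_less_abs_iff)
  then have "z = x" using z x by simp
  then show ?thesis using conj_eq_iff_commute[OF x y] by (simp add: z_def)
qed

text \<open>The conjugates of \<open>x\<close> by the powers of \<open>y\<close> cannot all be different.\<close>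

lemma some_power_commutes:
  assumes fin: "finite (conjugates G x)" and x: "x \<in> carrier G" and y: "y \<in> carrier G"
  obtains m :: nat where "m > 0" "y [^] m \<otimes> x = x \<otimes> y [^] m"
proof -
  define f where "f = (\<lambda>i::nat. y [^] i \<otimes> x \<otimes> inv (y [^] i))"
  have "range f \<subseteq> conjugates G x" using y by (auto simp: f_def conjugates_def)
  then have "finite (range f)" using fin finite_subset by blast
  then have "\<not> inj f" using finite_imageD[of f UNIV] by auto
  then obtain i j where ij: "f i = f j" "i < j"
    unfolding inj_def by (metis linorder_neqE_nat)
  define m where "m = j - i"
  have j: "y [^] j = y [^] i \<otimes> y [^] m" using ij y by (simp add: m_def nat_pow_mult)
  have "x = y [^] m \<otimes> x \<otimes> inv (y [^] m)"
  proof -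
    have "inv (y [^] i) \<otimes> f i \<otimes> y [^] i = x" using x y by (simp add: f_def free_reduce)
    moreover have "inv (y [^] i) \<otimes> f j \<otimes> y [^] i = y [^] m \<otimes> x \<otimes> inv (y [^] m)"
      using x y by (simp add: f_def j free_reduce del: nat_pow_mult)
    ultimately show ?thesis using ij by simp
  qed
  then have "x \<otimes> y [^] m = y [^] m \<otimes> x"
    using conj_eq_iff_commute[of x "y [^] m"] x y by simp
  then show ?thesis using ij that[of m] by (simp add: m_def)
qed

text \<open>In a torsion-free abelian group square roots are unique. So the conjugates of \<open>y\<close>, which all lie
  in \<open>N\<close>, are determined by their squares, and these are conjugates of \<open>y\<^sup>2\<close>.\<close>

lemma finite_conjugates_of_square:
  assumes tf: "torsion_free G" and N: "N \<lhd> G" and com: "\<And>u v. u \<in> N \<Longrightarrow> v \<in> N \<Longrightarrow> u \<otimes> v = v \<otimes> u"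
    and y: "y \<in> N" and fin: "finite (conjugates G (y \<otimes> y))"
  shows "finite (conjugates G y)"
proof -
  have Nc: "N \<subseteq> carrier G" using N normal_imp_subgroup subgroup.subset by blast
  have conjN: "conjugates G y \<subseteq> N"
    using N y by (auto simp: conjugates_def normal_inv_iff)
  have "inj_on (\<lambda>u. u \<otimes> u) N"
  proof (rule inj_onI)
    fix u v assume u: "u \<in> N" and v: "v \<in> N" and eq: "u \<otimes> u = v \<otimes> v"
    have uv: "u \<in> carrier G" "v \<in> carrier G" using u v Nc by auto
    have iv: "inv v \<otimes> u = u \<otimes> inv v" using commute_inv com uv u v by metis
    have "(u \<otimes> inv v) [^] (2::nat) = u \<otimes> (inv v \<otimes> u) \<otimes> inv v"
      using uv by (simp add: numeral_2_eq_2 m_assoc)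
    also have "\<dots> = (u \<otimes> u) \<otimes> inv v \<otimes> inv v" unfolding iv using uv by (simp add: m_assoc)
    also have "\<dots> = \<one>" unfolding eq using uv by (simp add: free_reduce)
    finally have "u \<otimes> inv v = \<one>"
      using tf uv unfolding torsion_free_def by (metis inv_closed m_closed pos2)
    then show "u = v" using uv by (metis inv_equality inv_inv inv_closed)
  qed
  then have "inj_on (\<lambda>u. u \<otimes> u) (conjugates G y)" using conjN inj_on_subset by blast
  moreover have "(\<lambda>u. u \<otimes> u) ` conjugates G y \<subseteq> conjugates G (y \<otimes> y)"
    using y Nc by (auto simp: conjugates_def free_reduce subset_iff image_iff)
  ultimately show ?thesis using fin finite_subset finite_imageD by blast
qed

text \<open>The elements that commute with a given one modulo \<open>N\<close> form a subgroup. This is used for each of the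
  two arguments of the commutator in turn.\<close>

lemma commutators_in_normal_subgroup:
  assumes N: "N \<lhd> G" and S: "S \<subseteq> carrier G" "generate G S = carrier G"
    and SN: "\<And>x y. x \<in> S \<Longrightarrow> y \<in> S \<Longrightarrow> x \<otimes> y \<otimes> inv x \<otimes> inv y \<in> N"
  shows "derived G (carrier G) \<subseteq> N"
proof -
  have sub: "subgroup N G" using N normal_imp_subgroup by blast
  have conjN: "g \<otimes> h \<otimes> inv g \<in> N" if "g \<in> carrier G" "h \<in> N" for g h
    using N that by (auto simp: normal_inv_iff)
  have sym: "y \<otimes> x \<otimes> inv y \<otimes> inv x \<in> N"
    if "x \<in> carrier G" "y \<in> carrier G" "x \<otimes> y \<otimes> inv x \<otimes> inv y \<in> N" for x y
    using subgroup.m_inv_closed[OF sub that(3)] that by (simp add: free_reduce)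
  have ext: "x \<otimes> y \<otimes> inv x \<otimes> inv y \<in> N"
    if "x \<in> generate G S" "y \<in> carrier G" and Sy: "\<And>s. s \<in> S \<Longrightarrow> s \<otimes> y \<otimes> inv s \<otimes> inv y \<in> N" for x y
    using that(1)
  proof induction
    case one
    then show ?case using that sub by (simp add: subgroup.one_closed)
  next
    case (incl h)
    then show ?case using Sy by simp
  next
    case (inv h)
    then have h: "h \<in> carrier G" using S by auto
    have "inv h \<otimes> (y \<otimes> h \<otimes> inv y \<otimes> inv h) \<otimes> inv (inv h) \<in> N"
      using conjN[of "inv h"] sym[of h y] Sy inv h that by simp
    then show ?case using h that by (simp add: free_reduce)
  next
    case (eng h1 h2)
    then have h: "h1 \<in> carrier G" "h2 \<in> carrier G" using S by auto
    have "(h1 \<otimes> (h2 \<otimes> y \<otimes> inv h2 \<otimes> inv y) \<otimes> inv h1) \<otimes> (h1 \<otimes> y \<otimes> inv h1 \<otimes> inv y) \<in> N"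
      using conjN h eng subgroup.m_closed[OF sub] by blast
    then show ?case using h that by (simp add: free_reduce)
  qed
  have "x \<otimes> y \<otimes> inv x \<otimes> inv y \<in> N" if "x \<in> carrier G" "y \<in> carrier G" for x y
  proof (rule ext)
    show "s \<otimes> y \<otimes> inv s \<otimes> inv y \<in> N" if "s \<in> S" for s
    proof (rule sym)
      show "y \<otimes> s \<otimes> inv y \<otimes> inv s \<in> N"
        by (rule ext) (use S SN \<open>s \<in> S\<close> \<open>y \<in> carrier G\<close> in auto)
    qed (use \<open>s \<in> S\<close> S \<open>y \<in> carrier G\<close> in auto)
  qed (use that S in auto)
  then show ?thesis
    unfolding derived_def by (intro generate_subgroup_incl[OF _ sub]) auto
qed

text \<open>The centralizer is the kernel of the conjugation action on the finite set \<open>Y\<close>, so its cosets are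
  determined by the maps that they induce on \<open>Y\<close>.\<close>

lemma centralizer_of_finite_conjugation_closed_set:
  assumes Y: "finite Y" "Y \<subseteq> carrier G"
    and conj: "\<And>g x. g \<in> carrier G \<Longrightarrow> x \<in> Y \<Longrightarrow> g \<otimes> x \<otimes> inv g \<in> Y"
  defines "C \<equiv> {g \<in> carrier G. \<forall>x\<in>Y. g \<otimes> x = x \<otimes> g}"
  shows "subgroup C G" "finite (rcosets C)"
proof -
  show sub: "subgroup C G"
  proof (rule subgroupI)
    show "C \<noteq> {}" using Y by (auto simp: C_def intro!: exI[of _ \<one>])
    show "inv g \<in> C" if "g \<in> C" for g
      using that Y by (auto simp: C_def intro: commute_inv)
    show "g \<otimes> h \<in> C" if "g \<in> C" "h \<in> C" for g h
      using that Y by (auto simp: C_def subset_iff intro: commute_mult)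
  qed (auto simp: C_def)
  define f where "f = (\<lambda>g. restrict (\<lambda>x. inv g \<otimes> x \<otimes> g) Y)"
  have "f ` carrier G \<subseteq> (\<Pi>\<^sub>E x\<in>Y. Y)"
    using conj[OF inv_closed] by (auto simp: f_def)
  then have fin: "finite (f ` carrier G)"
    using Y finite_subset by (metis finite_PiE)
  have same: "C #> g = C #> h" if gh: "g \<in> carrier G" "h \<in> carrier G" "f g = f h" for g h
  proof -
    have "(g \<otimes> inv h) \<otimes> x = x \<otimes> (g \<otimes> inv h)" if x: "x \<in> Y" for x
    proof -
      have xc: "x \<in> carrier G" using x Y by auto
      have "inv g \<otimes> x \<otimes> g = inv h \<otimes> x \<otimes> h"
        using fun_cong[OF gh(3), of x] x by (simp add: f_def)
      then have "g \<otimes> (inv g \<otimes> x \<otimes> g) \<otimes> inv h = g \<otimes> (inv h \<otimes> x \<otimes> h) \<otimes> inv h" by simp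
      then show ?thesis using gh xc by (simp add: free_reduce)
    qed
    then have "g \<otimes> inv h \<in> C" using gh by (simp add: C_def)
    then show ?thesis
      using gh sub by (metis coset_mult_inv2 subgroup.subset coset_join2 coset_mult_assoc inv_closed
        m_closed coset_mult_inv1)
  qed
  have "rcosets C \<subseteq> (\<lambda>v. C #> (SOME g. g \<in> carrier G \<and> f g = v)) ` (f ` carrier G)"
  proof
    fix K assume "K \<in> rcosets C"
    then obtain g where g: "g \<in> carrier G" "K = C #> g" by (auto simp: RCOSETS_def)
    have "(SOME h. h \<in> carrier G \<and> f h = f g) \<in> carrier G \<and> f (SOME h. h \<in> carrier G \<and> f h = f g) = f g"
      by (rule someI) (use g in simp)
    then have "K = C #> (SOME h. h \<in> carrier G \<and> f h = f g)" using same g by metis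
    then show "K \<in> (\<lambda>v. C #> (SOME g. g \<in> carrier G \<and> f g = v)) ` (f ` carrier G)" using g by blast
  qed
  then show "finite (rcosets C)" using fin finite_surj by blast
qed

text \<open>The abelian subgroup of finite index is the centralizer \<open>C\<close> of the derived subgroup \<open>N\<close>. It is
  realized as the centralizer of the finite set \<open>Y\<close> of all conjugates of the commutators of generators.\<close>

theorem virtually_abelian_of_almost_central_by_rank_one:
  assumes M: "almost_central_by_rank_one G M"
    and fg: "finitely_generated G" and tf: "torsion_free G" and met: "metabelian G"
  shows "virtually_abelian G"
proof -
  define N where "N = derived G (carrier G)"
  have subM: "subgroup M G" and comM: "\<And>x y. x \<in> carrier G \<Longrightarrow> y \<in> carrier G \<Longrightarrow> x \<otimes> y \<otimes> inv x \<otimes> inv y \<in> M"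
    and sqM: "\<And>x. x \<in> M \<Longrightarrow> finite (conjugates G (x \<otimes> x))"
    and r1M: "\<And>x y. x \<in> carrier G \<Longrightarrow> y \<in> carrier G \<Longrightarrow> \<exists>(p::int) (q::int).
        (p \<noteq> 0 \<or> q \<noteq> 0) \<and> x [^] (p::int) \<otimes> y [^] (q::int) \<in> M"
    using M by (auto simp: almost_central_by_rank_one_def)
  have N: "N \<lhd> G" using derived_is_normal[OF normal_self] by (simp add: N_def)
  have subN: "subgroup N G" using N normal_imp_subgroup by blast
  have Nc: "N \<subseteq> carrier G" using subN subgroup.subset by blast
  have Ncom: "u \<otimes> v = v \<otimes> u" if "u \<in> N" "v \<in> N" for u v
  proof -
    have "comm_group (G\<lparr>carrier := N\<rparr>)"
      using met by (simp add: metabelian_def abelian_subgroup_def N_def)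
    then have "comm_monoid (G\<lparr>carrier := N\<rparr>)" by (rule comm_group.axioms(1))
    from comm_monoid.m_comm[OF this, of u v] show ?thesis using that by simp
  qed
  have NA: "N \<subseteq> M" unfolding N_def derived_def
    by (rule generate_subgroup_incl[OF _ subM]) (use comM in auto)
  have inN: "x \<otimes> y \<otimes> inv x \<otimes> inv y \<in> N" if "x \<in> carrier G" "y \<in> carrier G" for x y
    unfolding N_def derived_def by (rule generate.incl) (use that in auto)
  have fcN: "finite (conjugates G y)" if "y \<in> N" for y
    using finite_conjugates_of_square[OF tf N Ncom] that sqM NA by blast
  obtain S where S: "finite S" "S \<subseteq> carrier G" "generate G S = carrier G"
    using fg by (auto simp: finitely_generated_def)
  define Y where "Y = (\<Union>x\<in>S. \<Union>y\<in>S. conjugates G (x \<otimes> y \<otimes> inv x \<otimes> inv y))"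
  have finY: "finite Y" unfolding Y_def by (intro finite_UN_I S(1) fcN inN) (use S(2) in auto)
  have YN: "Y \<subseteq> N"
    using N inN S by (auto simp: Y_def conjugates_def normal_inv_iff subset_iff)
  have Yc: "Y \<subseteq> carrier G" using YN Nc by blast
  have conjY: "g \<otimes> x \<otimes> inv g \<in> Y" if g: "g \<in> carrier G" and x: "x \<in> Y" for g x
  proof -
    obtain s t h where sth: "s \<in> S" "t \<in> S" "h \<in> carrier G" "x = h \<otimes> (s \<otimes> t \<otimes> inv s \<otimes> inv t) \<otimes> inv h"
      using x by (auto simp: Y_def conjugates_def)
    define c where "c = s \<otimes> t \<otimes> inv s \<otimes> inv t"
    have "c \<in> carrier G" using sth S by (auto simp: c_def)
    then have "g \<otimes> x \<otimes> inv g = (g \<otimes> h) \<otimes> c \<otimes> inv (g \<otimes> h)"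
      using sth g unfolding c_def[symmetric] by (simp add: free_reduce)
    then have "g \<otimes> x \<otimes> inv g \<in> conjugates G c" using sth g by (auto simp: conjugates_def)
    then show ?thesis using sth by (auto simp: Y_def c_def)
  qed
  define C where "C = {g \<in> carrier G. \<forall>x\<in>Y. g \<otimes> x = x \<otimes> g}"
  have subC: "subgroup C G" and finC: "finite (rcosets C)"
    using centralizer_of_finite_conjugation_closed_set[OF finY Yc conjY] by (simp_all add: C_def)
  have Cc: "C \<subseteq> carrier G" by (auto simp: C_def)
  have NY: "N \<subseteq> generate G Y"
    unfolding N_def
  proof (rule commutators_in_normal_subgroup[OF _ S(2,3)])
    show "generate G Y \<lhd> G" by (rule normal_generateI) (use Yc conjY in auto)
    fix x y assume "x \<in> S" "y \<in> S"
    moreover from this have "x \<otimes> y \<otimes> inv x \<otimes> inv y = \<one> \<otimes> (x \<otimes> y \<otimes> inv x \<otimes> inv y) \<otimes> inv \<one>"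
      using S by (auto simp: subset_iff)
    ultimately have "x \<otimes> y \<otimes> inv x \<otimes> inv y \<in> Y"
      unfolding Y_def conjugates_def by blast
    then show "x \<otimes> y \<otimes> inv x \<otimes> inv y \<in> generate G Y" by (rule generate.incl)
  qed
  have CN: "n \<otimes> c = c \<otimes> n" if c: "c \<in> C" and n: "n \<in> N" for c n
  proof -
    have "n \<in> generate G Y" using n NY by auto
    then show ?thesis
    proof induction
      case one
      then show ?case using c Cc by auto
    next
      case (incl h)
      then show ?case using c by (auto simp: C_def)
    next
      case (inv h)
      then show ?case using c Yc by (intro commute_inv) (auto simp: C_def)
    next
      case (eng h1 h2)
      then show ?case using c Cc Yc by (intro commute_mult) (auto simp: generate_in_carrier)
    qed
  qed
  \<comment> \<open>commutators with elements of \<open>C\<close> lie in \<open>N\<close> and are centralized by \<open>C\<close>, so roots can be extracted\<close>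
  have root: "x \<otimes> y = y \<otimes> x"
    if x: "x \<in> C" and y: "y \<in> carrier G" and p: "p \<noteq> 0" "x [^] (p::int) \<otimes> y = y \<otimes> x [^] p" for x y p
  proof (rule commute_of_commute_int_pow[OF tf _ y _ p])
    have xc: "x \<in> carrier G" using x Cc by auto
    have "inv x \<otimes> y \<otimes> inv (inv x) \<otimes> inv y \<in> N" using inN xc y by blast
    then have "inv x \<otimes> (y \<otimes> x \<otimes> inv y) \<in> N" using xc y by (simp add: m_assoc)
    then show "x \<otimes> (inv x \<otimes> (y \<otimes> x \<otimes> inv y)) = inv x \<otimes> (y \<otimes> x \<otimes> inv y) \<otimes> x"
      using CN x by metis
  qed (use x Cc in auto)
  \<comment> \<open>some power of \<open>y\<close> commutes with \<open>a\<^sup>2\<close>; extract the roots of \<open>y\<close> and of \<open>a\<close>\<close>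
  have central: "a \<otimes> y = y \<otimes> a" if a: "a \<in> M" "a \<in> C" and y: "y \<in> C" for a y
  proof -
    have ac: "a \<in> carrier G" "y \<in> carrier G" using a y Cc by auto
    obtain m :: nat where m: "m > 0" "y [^] m \<otimes> (a \<otimes> a) = (a \<otimes> a) \<otimes> y [^] m"
      using some_power_commutes[OF sqM[OF a(1)], of y] ac by auto
    have "y \<otimes> (a \<otimes> a) = (a \<otimes> a) \<otimes> y"
      by (rule root[OF y, of _ "int m"]) (use m ac in \<open>auto simp: int_pow_int\<close>)
    then have "a [^] (2::int) \<otimes> y = y \<otimes> a [^] (2::int)"
      using ac by (simp add: int_pow_def2 numeral_2_eq_2)
    then show ?thesis by (intro root[OF a(2), of _ 2]) (use ac in auto)
  qed
  \<comment> \<open>since \<open>w = x\<^sup>p y\<^sup>q\<close> is central in \<open>C\<close>, the power \<open>x\<^sup>p\<close> commutes with \<open>y\<close>, and \<open>y\<^sup>q\<close> with \<open>x\<close>\<close>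
  have Ccom: "x \<otimes> y = y \<otimes> x" if x: "x \<in> C" and y: "y \<in> C" for x y
  proof -
    have c: "x \<in> carrier G" "y \<in> carrier G" using x y Cc by auto
    obtain p q :: int where pq: "p \<noteq> 0 \<or> q \<noteq> 0" "x [^] (p::int) \<otimes> y [^] (q::int) \<in> M"
      using r1M c by blast
    define w where "w = x [^] p \<otimes> y [^] q"
    have wA: "w \<in> M" "w \<in> C"
      using pq x y subC by (auto simp: w_def subgroup_int_pow_closed subgroup.m_closed)
    have wc: "w \<in> carrier G" using wA Cc by auto
    have px: "x [^] p = w \<otimes> y [^] (- q)" and py: "y [^] q = x [^] (- p) \<otimes> w"
      using c by (simp_all add: w_def int_pow_neg free_reduce)
    have "x [^] p \<otimes> y = y \<otimes> x [^] p" unfolding px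
      by (rule commute_mult) (use c wc wA central y in \<open>auto intro: commute_int_pow\<close>)
    moreover have "y [^] q \<otimes> x = x \<otimes> y [^] q" unfolding py
      by (rule commute_mult) (use c wc wA central x in \<open>auto intro: commute_int_pow\<close>)
    ultimately show ?thesis
      using pq root[OF x c(2), of p] root[OF y c(1), of q] by metis
  qed
  have "comm_group (G\<lparr>carrier := C\<rparr>)"
    by (rule group.group_comm_groupI[OF subgroup_imp_group[OF subC]]) (simp add: Ccom)
  then show ?thesis
    using subC finC by (auto simp: virtually_abelian_def abelian_subgroup_def)
qed

end

text \<open>A conjugacy class of a subgroup is contained in that of the whole group, and a homomorphism maps
  conjugacy classes onto conjugacy classes of the image, so finiteness is inherited.\<close>

lemma almost_central_by_rank_one_image:
  assumes G: "group G" and Q: "group Q" and H: "subgroup H G"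
    and \<phi>: "\<phi> \<in> hom (G\<lparr>carrier := H\<rparr>) Q" "\<phi> ` H = carrier Q"
    and M: "almost_central_by_rank_one G M"
  shows "almost_central_by_rank_one Q (\<phi> ` (H \<inter> M))"
proof -
  interpret G: group G by fact
  interpret Q: group Q by fact
  define H' where "H' = G\<lparr>carrier := H\<rparr>"
  have H'c: "carrier H' = H" "monoid.mult H' = monoid.mult G" by (simp_all add: H'_def)
  have gH': "group H'" unfolding H'_def using H G.subgroup_imp_group by blast
  interpret \<phi>: group_hom H' Q \<phi>
    using gH' \<phi>(1) Q by (simp add: group_hom_def group_hom_axioms_def H'_def)
  have Hc: "H \<subseteq> carrier G" using H subgroup.subset by blast
  have invH: "inv\<^bsub>H'\<^esub> x = inv\<^bsub>G\<^esub> x" if "x \<in> H" for x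
    unfolding H'_def using G.m_inv_consistent[OF H that] by simp
  have powH: "x [^]\<^bsub>H'\<^esub> (p::int) = x [^]\<^bsub>G\<^esub> p" if "x \<in> H" for x p
    unfolding H'_def using G.int_pow_consistent[OF H that] by simp
  have mult: "\<phi> (x \<otimes>\<^bsub>G\<^esub> y) = \<phi> x \<otimes>\<^bsub>Q\<^esub> \<phi> y" if "x \<in> H" "y \<in> H" for x y
    using \<phi>.hom_mult[of x y] that by (simp add: H'c)
  have inv: "\<phi> (inv\<^bsub>G\<^esub> x) = inv\<^bsub>Q\<^esub> \<phi> x" if "x \<in> H" for x
    using \<phi>.hom_inv[of x] that by (simp add: H'c invH)
  have pow: "\<phi> (x [^]\<^bsub>G\<^esub> p) = \<phi> x [^]\<^bsub>Q\<^esub> (p::int)" if "x \<in> H" for x p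
    using \<phi>.hom_int_pow[of x p] that by (simp add: H'c powH)
  have closed: "x \<otimes>\<^bsub>G\<^esub> y \<in> H" "inv\<^bsub>G\<^esub> x \<in> H" "x [^]\<^bsub>G\<^esub> (p::int) \<in> H" if "x \<in> H" "y \<in> H" for x y p
    using that H by (auto simp: subgroup.m_closed subgroup.m_inv_closed G.subgroup_int_pow_closed)
  have lift: "\<exists>x\<in>H. u = \<phi> x" if "u \<in> carrier Q" for u using that \<phi>(2) by blast
  have subM: "subgroup M G"
    and comM: "\<And>x y. x \<in> carrier G \<Longrightarrow> y \<in> carrier G \<Longrightarrow> x \<otimes>\<^bsub>G\<^esub> y \<otimes>\<^bsub>G\<^esub> inv\<^bsub>G\<^esub> x \<otimes>\<^bsub>G\<^esub> inv\<^bsub>G\<^esub> y \<in> M"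
    and sqM: "\<And>x. x \<in> M \<Longrightarrow> finite (conjugates G (x \<otimes>\<^bsub>G\<^esub> x))"
    and r1M: "\<And>x y. x \<in> carrier G \<Longrightarrow> y \<in> carrier G \<Longrightarrow> \<exists>(p::int) (q::int).
        (p \<noteq> 0 \<or> q \<noteq> 0) \<and> x [^]\<^bsub>G\<^esub> p \<otimes>\<^bsub>G\<^esub> y [^]\<^bsub>G\<^esub> q \<in> M"
    using M by (simp_all add: almost_central_by_rank_one_def)
  show ?thesis
    unfolding almost_central_by_rank_one_def
  proof (intro conjI ballI)
    have "subgroup (H \<inter> M) H'" unfolding H'_def
      by (rule G.subgroup_incl[OF G.subgroups_Inter_pair[OF H subM] H]) simp
    then show "subgroup (\<phi> ` (H \<inter> M)) Q" by (rule \<phi>.subgroup_img_is_subgroup)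
  next
    fix u v assume "u \<in> carrier Q" "v \<in> carrier Q"
    then obtain x y where xy: "x \<in> H" "y \<in> H" "u = \<phi> x" "v = \<phi> y" using lift by blast
    have "x \<otimes>\<^bsub>G\<^esub> y \<otimes>\<^bsub>G\<^esub> inv\<^bsub>G\<^esub> x \<otimes>\<^bsub>G\<^esub> inv\<^bsub>G\<^esub> y \<in> H \<inter> M"
      using xy Hc comM[of x y] by (simp add: closed subsetD)
    moreover have "u \<otimes>\<^bsub>Q\<^esub> v \<otimes>\<^bsub>Q\<^esub> inv\<^bsub>Q\<^esub> u \<otimes>\<^bsub>Q\<^esub> inv\<^bsub>Q\<^esub> v = \<phi> (x \<otimes>\<^bsub>G\<^esub> y \<otimes>\<^bsub>G\<^esub> inv\<^bsub>G\<^esub> x \<otimes>\<^bsub>G\<^esub> inv\<^bsub>G\<^esub> y)"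
      using xy by (simp add: mult inv closed)
    ultimately show "u \<otimes>\<^bsub>Q\<^esub> v \<otimes>\<^bsub>Q\<^esub> inv\<^bsub>Q\<^esub> u \<otimes>\<^bsub>Q\<^esub> inv\<^bsub>Q\<^esub> v \<in> \<phi> ` (H \<inter> M)" by blast
    obtain p q :: int where pq: "p \<noteq> 0 \<or> q \<noteq> 0" "x [^]\<^bsub>G\<^esub> p \<otimes>\<^bsub>G\<^esub> y [^]\<^bsub>G\<^esub> q \<in> M"
      using r1M[of x y] xy Hc by blast
    have "u [^]\<^bsub>Q\<^esub> p \<otimes>\<^bsub>Q\<^esub> v [^]\<^bsub>Q\<^esub> q = \<phi> (x [^]\<^bsub>G\<^esub> p \<otimes>\<^bsub>G\<^esub> y [^]\<^bsub>G\<^esub> q)"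
      using xy by (simp add: mult pow closed)
    moreover have "x [^]\<^bsub>G\<^esub> p \<otimes>\<^bsub>G\<^esub> y [^]\<^bsub>G\<^esub> q \<in> H" using xy by (simp add: closed)
    ultimately show "\<exists>(p::int) (q::int). (p \<noteq> 0 \<or> q \<noteq> 0) \<and> u [^]\<^bsub>Q\<^esub> p \<otimes>\<^bsub>Q\<^esub> v [^]\<^bsub>Q\<^esub> q \<in> \<phi> ` (H \<inter> M)"
      using pq \<open>x [^]\<^bsub>G\<^esub> p \<otimes>\<^bsub>G\<^esub> y [^]\<^bsub>G\<^esub> q \<in> H\<close> by (intro exI[of _ p] exI[of _ q] conjI) auto
  next
    fix u assume "u \<in> \<phi> ` (H \<inter> M)"
    then obtain x where x: "x \<in> H" "x \<in> M" "u = \<phi> x" by blast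
    have "conjugates Q (u \<otimes>\<^bsub>Q\<^esub> u) \<subseteq> \<phi> ` conjugates G (x \<otimes>\<^bsub>G\<^esub> x)"
    proof
      fix w assume "w \<in> conjugates Q (u \<otimes>\<^bsub>Q\<^esub> u)"
      then obtain g where g: "g \<in> H" "w = \<phi> g \<otimes>\<^bsub>Q\<^esub> (u \<otimes>\<^bsub>Q\<^esub> u) \<otimes>\<^bsub>Q\<^esub> inv\<^bsub>Q\<^esub> \<phi> g"
        unfolding conjugates_def using lift by blast
      then have "w = \<phi> (g \<otimes>\<^bsub>G\<^esub> (x \<otimes>\<^bsub>G\<^esub> x) \<otimes>\<^bsub>G\<^esub> inv\<^bsub>G\<^esub> g)"
        using x by (simp add: mult inv closed)
      then show "w \<in> \<phi> ` conjugates G (x \<otimes>\<^bsub>G\<^esub> x)" using g Hc by (auto simp: conjugates_def)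
    qed
    moreover have "finite (conjugates G (x \<otimes>\<^bsub>G\<^esub> x))"
      using sqM x by blast
    ultimately show "finite (conjugates Q (u \<otimes>\<^bsub>Q\<^esub> u))" using finite_surj by blast
  qed
qed

lemma virtually_abelian_subquotient:
  assumes G: "group G" and M: "almost_central_by_rank_one G M"
    and Q: "subquotient Q G" "finitely_generated Q" "torsion_free Q" "metabelian Q"
  shows "virtually_abelian Q"
proof -
  interpret G: group G by fact
  have gQ: "group Q" using Q by (simp add: subquotient_def)
  obtain H K where H: "subgroup H G" and K: "K \<lhd> (G\<lparr>carrier := H\<rparr>)"
    and iso: "Q \<cong> (G\<lparr>carrier := H\<rparr> Mod K)"
    using Q by (auto simp: subquotient_def)
  interpret K: normal K "G\<lparr>carrier := H\<rparr>" by fact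
  have "(G\<lparr>carrier := H\<rparr> Mod K) \<cong> Q" using iso group.iso_sym[OF gQ] by blast
  then obtain h where h: "h \<in> iso (G\<lparr>carrier := H\<rparr> Mod K) Q" by (auto simp: is_iso_def)
  define \<phi> where "\<phi> = h \<circ> (\<lambda>x. K #>\<^bsub>G\<lparr>carrier := H\<rparr>\<^esub> x)"
  have hom: "\<phi> \<in> hom (G\<lparr>carrier := H\<rparr>) Q"
    unfolding \<phi>_def by (rule Group.hom_compose[OF K.r_coset_hom_Mod]) (use h in \<open>simp add: iso_def\<close>)
  have "\<phi> ` H = h ` carrier (G\<lparr>carrier := H\<rparr> Mod K)"
    by (auto simp: \<phi>_def FactGroup_def RCOSETS_def)
  then have surj: "\<phi> ` H = carrier Q" using h by (auto simp: iso_def bij_betw_def)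
  show ?thesis
    using group.virtually_abelian_of_almost_central_by_rank_one[OF gQ
        almost_central_by_rank_one_image[OF G gQ H hom surj M]] Q by blast
qed

section \<open>The infinite dihedral group acting on the integers\<close>

lemma pres_eq_context: "pres_eq R u v \<Longrightarrow> pres_eq R (w @ u @ z) (w @ v @ z)"
proof (induction rule: pres_eq.induct)
  case (sym u v)
  show ?case using sym.IH by (rule pres_eq.sym)
next
  case (trans u v x)
  then show ?case by (blast intro: pres_eq.trans)
next
  case (cancel u x e v)
  show ?case using pres_eq.cancel[of R "w @ u" x e "v @ z"] by simp
next
  case (relator r u v)
  then show ?case using pres_eq.relator[of r R "w @ u" "v @ z"] by simp
qed (rule pres_eq.refl)

lemma pres_eq_append: "pres_eq R u u' \<Longrightarrow> pres_eq R v v' \<Longrightarrow> pres_eq R (u @ v) (u' @ v')"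
  using pres_eq_context[of R u u' "[]" v] pres_eq_context[of R v v' u' "[]"] pres_eq.trans by auto

lemma word_class_eq_iff: "word_class R u = word_class R v \<longleftrightarrow> pres_eq R u v"
  unfolding word_class_def by (blast intro: pres_eq.intros)

lemma presented_group_mult:
  "word_class R u \<otimes>\<^bsub>presented_group R\<^esub> word_class R v = word_class R (u @ v)"
proof -
  have "word_class R (u' @ v') = word_class R (u @ v)" if "u' \<in> word_class R u" "v' \<in> word_class R v" for u' v'
    unfolding word_class_eq_iff using that
    by (auto simp: word_class_def intro: pres_eq.sym pres_eq_append)
  moreover have "u \<in> word_class R u" "v \<in> word_class R v"
    by (simp_all add: word_class_def pres_eq.refl)
  ultimately have "(\<Union>u'\<in>word_class R u. \<Union>v'\<in>word_class R v. word_class R (u' @ v')) = word_class R (u @ v)"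
    by blast
  then show ?thesis by (simp add: presented_group_def)
qed

lemma inverse_word: "pres_eq R (rev (map (\<lambda>(x, e). (x, \<not> e)) w) @ w) []"
proof (induction w)
  case (Cons l w)
  obtain x e where l: "l = (x, e)" by force
  let ?v = "rev (map (\<lambda>(x, e). (x, \<not> e)) w)"
  have "pres_eq R (?v @ [(x, \<not> e), (x, \<not> \<not> e)] @ w) (?v @ w)" by (rule pres_eq.cancel)
  then show ?case using Cons.IH by (auto simp: l intro: pres_eq.trans)
qed (simp add: pres_eq.refl)

lemma group_presented_group: "group (presented_group R)"
proof (rule groupI)
  fix U assume "U \<in> carrier (presented_group R)"
  then obtain u where u: "U = word_class R u" by (auto simp: presented_group_def)
  have one: "\<one>\<^bsub>presented_group R\<^esub> = word_class R []" by (simp add: presented_group_def)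
  show "\<one>\<^bsub>presented_group R\<^esub> \<otimes>\<^bsub>presented_group R\<^esub> U = U"
    by (simp add: u one presented_group_mult)
  have "word_class R (rev (map (\<lambda>(x, e). (x, \<not> e)) u)) \<otimes>\<^bsub>presented_group R\<^esub> U = \<one>\<^bsub>presented_group R\<^esub>"
    by (simp add: u one presented_group_mult word_class_eq_iff inverse_word)
  then show "\<exists>V\<in>carrier (presented_group R). V \<otimes>\<^bsub>presented_group R\<^esub> U = \<one>\<^bsub>presented_group R\<^esub>"
    by (auto simp: presented_group_def)
next
  fix U V W assume "U \<in> carrier (presented_group R)" "V \<in> carrier (presented_group R)"
    "W \<in> carrier (presented_group R)"
  then obtain u v w where "U = word_class R u" "V = word_class R v" "W = word_class R w"
    by (auto simp: presented_group_def)
  then show "U \<otimes>\<^bsub>presented_group R\<^esub> V \<otimes>\<^bsub>presented_group R\<^esub> W = U \<otimes>\<^bsub>presented_group R\<^esub> (V \<otimes>\<^bsub>presented_group R\<^esub> W)"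
    by (simp add: presented_group_mult)
next
  fix U V assume "U \<in> carrier (presented_group R)" "V \<in> carrier (presented_group R)"
  then obtain u v where "U = word_class R u" "V = word_class R v"
    by (auto simp: presented_group_def)
  then show "U \<otimes>\<^bsub>presented_group R\<^esub> V \<in> carrier (presented_group R)"
    by (simp add: presented_group_mult) (simp add: presented_group_def)
qed (simp add: presented_group_def)

text \<open>The pair \<open>(r, m)\<close> is the isometry \<open>x \<mapsto> m - x\<close> of the integers if \<open>r\<close> holds, and the translation
  \<open>x \<mapsto> m + x\<close> otherwise. The generators act by \<open>a: x \<mapsto> -x\<close> and \<open>b: x \<mapsto> 1 - x\<close>, so \<open>b a\<close> is the translation
  by \<open>1\<close>. The signs of the exponents in a word are ignored because both generators are involutions.\<close>

type_synonym isometry = "bool \<times> int"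

definition isometry_mult :: "isometry \<Rightarrow> isometry \<Rightarrow> isometry" where
  "isometry_mult u v = (fst u \<noteq> fst v, snd u + (if fst u then - snd v else snd v))"

primrec letter_val :: "dgen \<Rightarrow> isometry" where
  "letter_val A = (True, 0)"
| "letter_val B = (True, 1)"

definition word_val :: "dgen word \<Rightarrow> isometry" where
  "word_val w = foldr (\<lambda>l. isometry_mult (letter_val (fst l))) w (False, 0)"

lemma isometry_mult_assoc: "isometry_mult (isometry_mult u v) w = isometry_mult u (isometry_mult v w)"
  by (auto simp: isometry_mult_def)

lemma isometry_mult_one [simp]: "isometry_mult (False, 0) u = u" "isometry_mult u (False, 0) = u"
  by (auto simp: isometry_mult_def prod_eq_iff)

lemma letter_val_involution: "isometry_mult (letter_val x) (isometry_mult (letter_val x) v) = v"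
  by (cases x) (auto simp: isometry_mult_def prod_eq_iff)

lemma word_val_Nil [simp]: "word_val [] = (False, 0)"
  and word_val_Cons [simp]: "word_val (l # w) = isometry_mult (letter_val (fst l)) (word_val w)"
  by (simp_all add: word_val_def)

lemma word_val_append [simp]: "word_val (u @ v) = isometry_mult (word_val u) (word_val v)"
  by (induction u) (simp_all add: isometry_mult_assoc)

lemma word_val_cong: "pres_eq dihedral_relators u v \<Longrightarrow> word_val u = word_val v"
proof (induction rule: pres_eq.induct)
  case (relator r u v)
  then show ?case by (auto simp: isometry_mult_assoc) (simp_all add: isometry_mult_def prod_eq_iff)
qed (simp_all add: letter_val_involution)

definition isometry_of :: "dihedral \<Rightarrow> isometry" where
  "isometry_of U = word_val (SOME u. u \<in> U)"

lemma isometry_of_word_class [simp]: "isometry_of (word_class dihedral_relators w) = word_val w"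
proof -
  have "(SOME u. u \<in> word_class dihedral_relators w) \<in> word_class dihedral_relators w"
    by (rule someI[of _ w]) (simp add: word_class_def pres_eq.refl)
  then show ?thesis
    unfolding isometry_of_def by (metis word_val_cong word_class_def mem_Collect_eq)
qed

lemma group_Dinf: "group Dinf"
  by (simp add: Dinf_def group_presented_group)

lemma carrier_Dinf: "carrier Dinf = range (word_class dihedral_relators)"
  by (simp add: Dinf_def presented_group_def)

lemma Dinf_mult:
  "word_class dihedral_relators u \<otimes>\<^bsub>Dinf\<^esub> word_class dihedral_relators v = word_class dihedral_relators (u @ v)"
  by (simp add: Dinf_def presented_group_mult)

lemma one_Dinf: "\<one>\<^bsub>Dinf\<^esub> = word_class dihedral_relators []"
  by (simp add: Dinf_def presented_group_def)

lemma gens_in_Dinf: "gen_a \<in> carrier Dinf" "gen_b \<in> carrier Dinf"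
  by (simp_all add: carrier_Dinf gen_a_def gen_b_def)

lemma gen_squares: "gen_a \<otimes>\<^bsub>Dinf\<^esub> gen_a = \<one>\<^bsub>Dinf\<^esub>" "gen_b \<otimes>\<^bsub>Dinf\<^esub> gen_b = \<one>\<^bsub>Dinf\<^esub>"
  using pres_eq.relator[of _ dihedral_relators "[]" "[]"]
  by (auto simp: gen_a_def gen_b_def Dinf_mult one_Dinf word_class_eq_iff)

lemma word_class_inverse_letter:
  "word_class dihedral_relators [(x, e)] = word_class dihedral_relators [(x, True)]"
proof (cases e)
  case False
  have "[(x, True), (x, True)] \<in> dihedral_relators" by (cases x) auto
  from pres_eq.relator[OF this, of "[]" "[(x, False)]"]
  have "pres_eq dihedral_relators [(x, True), (x, True), (x, False)] [(x, False)]" by simp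
  moreover have "pres_eq dihedral_relators [(x, True), (x, True), (x, False)] [(x, True)]"
    using pres_eq.cancel[of dihedral_relators "[(x, True)]" x True "[]"] by simp
  ultimately show ?thesis
    unfolding word_class_eq_iff using False by (auto intro: pres_eq.intros)
qed simp

text \<open>Normal form.\<close>

text \<open>Every element of the presented group has the form \<open>(b a)\<^sup>m\<close> or \<open>(b a)\<^sup>m a\<close>, since \<open>a\<close> inverts \<open>b a\<close> under
  conjugation. Both the exponent and the presence of the last factor can be read off from the isometry,
  so the action on the integers is faithful.\<close>

lemma word_class_eq_rotation_times_reflection:
  "word_class dihedral_relators w =
     (gen_b \<otimes>\<^bsub>Dinf\<^esub> gen_a) [^]\<^bsub>Dinf\<^esub> snd (word_val w) \<otimes>\<^bsub>Dinf\<^esub>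
     (if fst (word_val w) then gen_a else \<one>\<^bsub>Dinf\<^esub>)"
proof -
  interpret D: group Dinf by (rule group_Dinf)
  define rho where "rho = gen_b \<otimes>\<^bsub>Dinf\<^esub> gen_a"
  define elt where "elt = (\<lambda>v::isometry. rho [^]\<^bsub>Dinf\<^esub> snd v \<otimes>\<^bsub>Dinf\<^esub> (if fst v then gen_a else \<one>\<^bsub>Dinf\<^esub>))"
  note gc [simp] = gens_in_Dinf
  have rc [simp]: "rho \<in> carrier Dinf" by (simp add: rho_def)
  have aa: "gen_a \<otimes>\<^bsub>Dinf\<^esub> (gen_a \<otimes>\<^bsub>Dinf\<^esub> u) = u" if "u \<in> carrier Dinf" for u
    using that gen_squares by (simp add: D.m_assoc[symmetric])
  have bb: "gen_b \<otimes>\<^bsub>Dinf\<^esub> (gen_b \<otimes>\<^bsub>Dinf\<^esub> u) = u" if "u \<in> carrier Dinf" for u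
    using that gen_squares by (simp add: D.m_assoc[symmetric])
  have ir: "inv\<^bsub>Dinf\<^esub> rho = gen_a \<otimes>\<^bsub>Dinf\<^esub> gen_b"
    by (rule D.inv_equality) (simp_all add: rho_def D.m_assoc bb gen_squares)
  have swap: "gen_a \<otimes>\<^bsub>Dinf\<^esub> u [^]\<^bsub>Dinf\<^esub> (n::nat) = v [^]\<^bsub>Dinf\<^esub> n \<otimes>\<^bsub>Dinf\<^esub> gen_a"
    if "u \<in> carrier Dinf" "v \<in> carrier Dinf" "gen_a \<otimes>\<^bsub>Dinf\<^esub> u = v \<otimes>\<^bsub>Dinf\<^esub> gen_a" for u v n
  proof (induction n)
    case (Suc n)
    have "gen_a \<otimes>\<^bsub>Dinf\<^esub> u [^]\<^bsub>Dinf\<^esub> Suc n = (gen_a \<otimes>\<^bsub>Dinf\<^esub> u [^]\<^bsub>Dinf\<^esub> n) \<otimes>\<^bsub>Dinf\<^esub> u"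
      using that by (simp add: D.m_assoc)
    also have "\<dots> = v [^]\<^bsub>Dinf\<^esub> n \<otimes>\<^bsub>Dinf\<^esub> (gen_a \<otimes>\<^bsub>Dinf\<^esub> u)"
      unfolding Suc.IH using that by (simp add: D.m_assoc)
    also have "\<dots> = v [^]\<^bsub>Dinf\<^esub> Suc n \<otimes>\<^bsub>Dinf\<^esub> gen_a"
      unfolding that(3) using that by (simp add: D.m_assoc)
    finally show ?case .
  qed (use that in simp)
  have s1: "gen_a \<otimes>\<^bsub>Dinf\<^esub> rho = inv\<^bsub>Dinf\<^esub> rho \<otimes>\<^bsub>Dinf\<^esub> gen_a"
    unfolding ir by (simp add: rho_def D.m_assoc)
  have s2: "gen_a \<otimes>\<^bsub>Dinf\<^esub> inv\<^bsub>Dinf\<^esub> rho = rho \<otimes>\<^bsub>Dinf\<^esub> gen_a"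
    unfolding ir by (simp add: rho_def D.m_assoc aa gen_squares)
  have rotate: "gen_a \<otimes>\<^bsub>Dinf\<^esub> rho [^]\<^bsub>Dinf\<^esub> m = rho [^]\<^bsub>Dinf\<^esub> (- m) \<otimes>\<^bsub>Dinf\<^esub> gen_a" for m :: int
  proof (cases m rule: int_cases2)
    case (nonneg n)
    then show ?thesis using swap[OF _ _ s1, of n] by (simp add: D.int_pow_neg_int D.nat_pow_inv int_pow_int)
  next
    case (nonpos n)
    then show ?thesis using swap[OF _ _ s2, of n] by (simp add: D.int_pow_neg_int D.nat_pow_inv int_pow_int)
  qed
  have a: "gen_a \<otimes>\<^bsub>Dinf\<^esub> elt v = elt (isometry_mult (letter_val A) v)" for v
    by (simp add: elt_def isometry_mult_def D.m_assoc[symmetric] rotate)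
       (simp add: D.m_assoc gen_squares)
  have "gen_b = rho \<otimes>\<^bsub>Dinf\<^esub> gen_a" by (simp add: rho_def D.m_assoc gen_squares)
  then have b: "gen_b \<otimes>\<^bsub>Dinf\<^esub> elt v = elt (isometry_mult (letter_val B) v)" for v
  proof -
    have ec: "elt u \<in> carrier Dinf" for u by (simp add: elt_def)
    have "gen_b \<otimes>\<^bsub>Dinf\<^esub> elt v = (rho \<otimes>\<^bsub>Dinf\<^esub> gen_a) \<otimes>\<^bsub>Dinf\<^esub> elt v" using \<open>gen_b = _\<close> by simp
    also have "\<dots> = rho \<otimes>\<^bsub>Dinf\<^esub> elt (isometry_mult (letter_val A) v)"
      using a[of v] ec by (simp add: D.m_assoc)
    also have "\<dots> = elt (isometry_mult (letter_val B) v)"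
      using D.int_pow_mult[of rho 1 "- snd v"] by (simp add: elt_def isometry_mult_def D.m_assoc[symmetric])
    finally show ?thesis .
  qed
  have "word_class dihedral_relators w = elt (word_val w)"
  proof (induction w)
    case Nil
    show ?case by (simp add: elt_def one_Dinf[symmetric])
  next
    case (Cons l w)
    have "word_class dihedral_relators (l # w) =
        word_class dihedral_relators [(fst l, snd l)] \<otimes>\<^bsub>Dinf\<^esub> word_class dihedral_relators w"
      by (simp add: Dinf_mult)
    then show ?case
      unfolding word_class_inverse_letter[of _ "snd l"] Cons
      by (cases "fst l") (simp_all add: a b flip: gen_a_def gen_b_def)
  qed
  then show ?thesis by (simp add: elt_def rho_def)
qed

lemma word_val_surj: "\<exists>w. word_val w = v"
proof -
  have pos: "word_val (concat (replicate n [(B, True), (A, True)])) = (False, int n)" for n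
    by (induction n) (simp_all add: isometry_mult_def)
  have neg: "word_val (concat (replicate n [(A, True), (B, True)])) = (False, - int n)" for n
    by (induction n) (simp_all add: isometry_mult_def)
  obtain w where w: "word_val w = (False, snd v)"
    using pos[of "nat (snd v)"] neg[of "nat (- snd v)"]
    by (cases "snd v \<ge> 0") auto
  have "word_val (w @ (if fst v then [(A, True)] else [])) = v"
    using w by (simp add: isometry_mult_def prod_eq_iff)
  then show ?thesis by blast
qed

lemma isometry_of_bij: "bij_betw isometry_of (carrier Dinf) UNIV"
proof (rule bij_betw_imageI)
  show "inj_on isometry_of (carrier Dinf)"
  proof (rule inj_onI)
    fix U V assume "U \<in> carrier Dinf" "V \<in> carrier Dinf" and eq: "isometry_of U = isometry_of V"
    then obtain u v where uv: "U = word_class dihedral_relators u" "V = word_class dihedral_relators v"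
      by (auto simp: carrier_Dinf)
    then have "word_val u = word_val v" using eq by simp
    then show "U = V"
      unfolding uv word_class_eq_rotation_times_reflection[of u] word_class_eq_rotation_times_reflection[of v]
      by simp
  qed
  show "isometry_of ` carrier Dinf = UNIV"
    using word_val_surj by (auto simp: carrier_Dinf image_iff) (metis isometry_of_word_class)
qed

lemma isometry_of_mult:
  "x \<in> carrier Dinf \<Longrightarrow> y \<in> carrier Dinf \<Longrightarrow> isometry_of (x \<otimes>\<^bsub>Dinf\<^esub> y) = isometry_mult (isometry_of x) (isometry_of y)"
  by (auto simp: carrier_Dinf Dinf_mult)

lemma isometry_of_one: "isometry_of \<one>\<^bsub>Dinf\<^esub> = (False, 0)"
  by (simp add: one_Dinf)

lemma isometry_of_gens: "isometry_of gen_a = (True, 0)" "isometry_of gen_b = (True, 1)"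
  by (simp_all add: gen_a_def gen_b_def)

definition dihedral_of :: "isometry \<Rightarrow> dihedral" where
  "dihedral_of = inv_into (carrier Dinf) isometry_of"

lemma dihedral_of_in_Dinf: "dihedral_of v \<in> carrier Dinf"
  using isometry_of_bij by (simp add: dihedral_of_def bij_betw_def inv_into_into)

lemma isometry_of_dihedral_of [simp]: "isometry_of (dihedral_of v) = v"
  using isometry_of_bij by (simp add: dihedral_of_def bij_betw_def f_inv_into_f)

text \<open>The abelianization of the dihedral group is a Klein four-group; its two coordinates count the letters
  \<open>a\<close> and \<open>b\<close> modulo two. Only \<open>b\<close> changes the parity of the translation part, and every letter changes
  the orientation.\<close>

definition reflects_a :: "isometry \<Rightarrow> bool" where "reflects_a v \<longleftrightarrow> (fst v \<noteq> odd (snd v))"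
definition reflects_b :: "isometry \<Rightarrow> bool" where "reflects_b v \<longleftrightarrow> odd (snd v)"

lemma reflects_isometry_mult:
  "reflects_a (isometry_mult u v) = (reflects_a u \<noteq> reflects_a v)"
  "reflects_b (isometry_mult u v) = (reflects_b u \<noteq> reflects_b v)"
  by (auto simp: reflects_a_def reflects_b_def isometry_mult_def)

lemma pow_rotation: "(isometry_mult (False, m) ^^ n) (False, 0) = (False, int n * m)"
  by (induction n) (simp_all add: isometry_mult_def algebra_simps)

lemma isometry_mult_conj_rotation: "isometry_mult v u = isometry_mult u (False, m) \<Longrightarrow> v = (False, m) \<or> v = (False, - m)"
  by (cases u; cases v) (auto simp: isometry_mult_def split: if_splits)

text \<open>The isometries \<open>1\<close>, \<open>a\<close> and \<open>b\<close>.\<close>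

definition standard :: "isometry set" where
  "standard = {(False, 0), (True, 0), (True, 1)}"

lemma standard_commutator:
  assumes "isometry_mult v (isometry_mult y x) = isometry_mult x y"
    and "x \<in> standard" "y \<in> standard"
  shows "v = (False, 2 * (if x = (True, 1) \<and> y = (True, 0) then 1
                          else if x = (True, 0) \<and> y = (True, 1) then -1 else 0))"
proof -
  obtain r m where v: "v = (r, m)" by force
  have "x = (False, 0) \<or> x = (True, 0) \<or> x = (True, 1)" "y = (False, 0) \<or> y = (True, 0) \<or> y = (True, 1)"
    using assms(2,3) by (simp_all add: standard_def)
  then show ?thesis
    using assms(1) unfolding v by (elim disjE; cases r; simp add: isometry_mult_def)
qed

section \<open>Coordinates on the ambient product\<close>

lemma group_semidirect_product:
  assumes N: "group N" and Q: "group Q"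
    and hom: "\<And>x. x \<in> carrier Q \<Longrightarrow> \<phi> x \<in> hom N N"
    and one: "\<And>f. f \<in> carrier N \<Longrightarrow> \<phi> \<one>\<^bsub>Q\<^esub> f = f"
    and act: "\<And>x y f. x \<in> carrier Q \<Longrightarrow> y \<in> carrier Q \<Longrightarrow> f \<in> carrier N \<Longrightarrow>
                \<phi> (x \<otimes>\<^bsub>Q\<^esub> y) f = \<phi> x (\<phi> y f)"
  shows "group (semidirect_product N Q \<phi>)"
proof -
  interpret N: group N by fact
  interpret Q: group Q by fact
  have closed: "\<phi> x f \<in> carrier N" if "x \<in> carrier Q" "f \<in> carrier N" for x f
    using hom[OF that(1)] that(2) by (auto simp: hom_def)
  have mult: "\<phi> x (f \<otimes>\<^bsub>N\<^esub> g) = \<phi> x f \<otimes>\<^bsub>N\<^esub> \<phi> x g" if "x \<in> carrier Q" "f \<in> carrier N" "g \<in> carrier N" for x f g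
    using hom[OF that(1)] that(2,3) by (auto simp: hom_def)
  show ?thesis
  proof (rule groupI)
    fix u assume "u \<in> carrier (semidirect_product N Q \<phi>)"
    then obtain f x where u: "u = (f, x)" "f \<in> carrier N" "x \<in> carrier Q"
      by (auto simp: semidirect_product_def)
    show "\<one>\<^bsub>semidirect_product N Q \<phi>\<^esub> \<otimes>\<^bsub>semidirect_product N Q \<phi>\<^esub> u = u"
      using u by (simp add: semidirect_product_def one)
    have "\<phi> (inv\<^bsub>Q\<^esub> x) (inv\<^bsub>N\<^esub> f) \<otimes>\<^bsub>N\<^esub> \<phi> (inv\<^bsub>Q\<^esub> x) f = \<phi> (inv\<^bsub>Q\<^esub> x) \<one>\<^bsub>N\<^esub>"
      using u by (simp add: mult[symmetric])
    also have "\<dots> = \<one>\<^bsub>N\<^esub>"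
      using hom_one[OF hom N N] u by simp
    finally show "\<exists>v\<in>carrier (semidirect_product N Q \<phi>).
        v \<otimes>\<^bsub>semidirect_product N Q \<phi>\<^esub> u = \<one>\<^bsub>semidirect_product N Q \<phi>\<^esub>"
      using u closed
      by (intro bexI[of _ "(\<phi> (inv\<^bsub>Q\<^esub> x) (inv\<^bsub>N\<^esub> f), inv\<^bsub>Q\<^esub> x)"]) (auto simp: semidirect_product_def)
  qed (auto simp: semidirect_product_def closed mult act N.m_assoc Q.m_assoc)
qed

lemma mod_range:
  assumes "k > 0"
  shows "1 \<le> i mod int k + 1" "i mod int k + 1 \<le> int k"
  using pos_mod_bound[of "int k" i] pos_mod_sign[of "int k" i] assms by linarith+

lemma cyclic_shift_hom:
  assumes "k > 0"
  shows "cyclic_shift k x \<in> hom (product_group {1..int k} (\<lambda>_. Dinf)) (product_group {1..int k} (\<lambda>_. Dinf))"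
proof -
  have r: "(j - x - 1) mod int k + 1 \<in> {1..int k}" for j
    using mod_range[OF assms, of "j - x - 1"] by simp
  have r': "1 \<le> (j - x - 1) mod int k + 1" "(j - x - 1) mod int k + 1 \<le> int k" for j
    using r[of j] by auto
  show ?thesis
  proof (rule homI)
    fix f assume "f \<in> carrier (product_group {1..int k} (\<lambda>_. Dinf))"
    then have f: "\<And>i. i \<in> {1..int k} \<Longrightarrow> f i \<in> carrier Dinf" by (auto simp: PiE_iff)
    show "cyclic_shift k x f \<in> carrier (product_group {1..int k} (\<lambda>_. Dinf))"
      unfolding cyclic_shift_def using f[OF r] by auto
  next
    fix f g
    show "cyclic_shift k x (f \<otimes>\<^bsub>product_group {1..int k} (\<lambda>_. Dinf)\<^esub> g) =
        cyclic_shift k x f \<otimes>\<^bsub>product_group {1..int k} (\<lambda>_. Dinf)\<^esub> cyclic_shift k x g"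
      by (rule ext) (simp add: cyclic_shift_def r')
  qed
qed

lemma group_H_group:
  assumes "k > 0"
  shows "group (H_group k)"
  unfolding H_group_def
proof (rule group_semidirect_product[OF _ _ cyclic_shift_hom[OF assms]])
  fix f assume "f \<in> carrier (product_group {1..int k} (\<lambda>_. Dinf))"
  then have f: "f \<in> extensional {1..int k}" by (auto simp: PiE_iff)
  show "cyclic_shift k \<one>\<^bsub>integer_mod_group k\<^esub> f = f"
  proof (rule ext)
    fix j
    show "cyclic_shift k \<one>\<^bsub>integer_mod_group k\<^esub> f j = f j"
    proof (cases "j \<in> {1..int k}")
      case True
      then have "(j - 1) mod int k = j - 1" by simp
      with True show ?thesis by (simp add: cyclic_shift_def)
    next
      case False
      then show ?thesis using f by (auto simp: cyclic_shift_def extensional_def)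
    qed
  qed
next
  fix x y f
  have r': "1 \<le> (j - x - 1) mod int k + 1" "(j - x - 1) mod int k + 1 \<le> int k" for j
    using mod_range[OF assms, of "j - x - 1"] by simp_all
  have e: "(j - (x + y) mod int k - 1) mod int k = ((j - x - 1) mod int k + 1 - y - 1) mod int k" for j
  proof -
    have 1: "j - (x + y) mod int k - 1 = (j - 1) - (x + y) mod int k" by linarith
    have 2: "j - 1 - (x + y) = (j - x - 1) - y" by linarith
    have "(j - (x + y) mod int k - 1) mod int k = (j - 1 - (x + y)) mod int k"
      unfolding 1 by (rule mod_diff_right_eq)
    also have "\<dots> = ((j - x - 1) mod int k - y) mod int k"
      unfolding 2 by (rule mod_diff_left_eq[symmetric])
    also have "(j - x - 1) mod int k - y = (j - x - 1) mod int k + 1 - y - 1" by linarith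
    finally show ?thesis .
  qed
  show "cyclic_shift k (x \<otimes>\<^bsub>integer_mod_group k\<^esub> y) f = cyclic_shift k x (cyclic_shift k y f)"
    by (rule ext) (simp only: cyclic_shift_def mult_integer_mod_group e restrict_apply atLeastAtMost_iff r' if_True simp_thms)
qed (simp_all add: group_Dinf)

abbreviation shift :: "ambient \<Rightarrow> nat \<Rightarrow> int" where
  "shift x n \<equiv> snd (snd x n)"

text \<open>Positions are counted from \<open>0\<close> and extended periodically, so that the action of the cyclic group
  becomes a translation of the argument \<open>j\<close>.\<close>

definition lamp :: "(nat \<Rightarrow> nat) \<Rightarrow> ambient \<Rightarrow> nat \<Rightarrow> int \<Rightarrow> isometry" where
  "lamp k x n j = isometry_of (fst (snd x n) (j mod int (k n) + 1))"

lemma group_Delta: "(\<And>n. n \<ge> 1 \<Longrightarrow> k n > 0) \<Longrightarrow> group (Delta k)"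
  unfolding Delta_def by (intro DirProd_group product_group group_integer_group) (simp add: group_H_group)

lemma mem_Delta_iff:
  "x \<in> carrier (Delta k) \<longleftrightarrow> snd x \<in> extensional {1..} \<and>
     (\<forall>n\<ge>1. fst (snd x n) \<in> (\<Pi>\<^sub>E j\<in>{1..int (k n)}. carrier Dinf) \<and>
            shift x n \<in> carrier (integer_mod_group (k n)))"
  by (cases x) (auto simp: Delta_def H_group_def semidirect_product_def PiE_iff mem_Times_iff)

lemma fst_mult [simp]: "fst (x \<otimes>\<^bsub>Delta k\<^esub> y) = fst x + fst y"
  by (cases x; cases y) (simp add: Delta_def)

lemma fst_one [simp]: "fst \<one>\<^bsub>Delta k\<^esub> = 0"
  by (simp add: Delta_def)

lemma snd_mult: "n \<ge> 1 \<Longrightarrow> snd (x \<otimes>\<^bsub>Delta k\<^esub> y) n = snd x n \<otimes>\<^bsub>H_group (k n)\<^esub> snd y n"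
  by (cases x; cases y) (simp add: Delta_def)

lemma shift_mult [simp]: "n \<ge> 1 \<Longrightarrow> shift (x \<otimes>\<^bsub>Delta k\<^esub> y) n = (shift x n + shift y n) mod int (k n)"
  by (simp add: snd_mult) (simp add: H_group_def semidirect_product_def case_prod_beta)

lemma shift_one [simp]: "n \<ge> 1 \<Longrightarrow> shift \<one>\<^bsub>Delta k\<^esub> n = 0"
  by (simp add: Delta_def H_group_def semidirect_product_def)

lemma lamp_cong: "j mod int (k n) = j' mod int (k n) \<Longrightarrow> lamp k x n j = lamp k x n j'"
  by (simp add: lamp_def)

lemma lamp_shift_mod: "lamp k x n (j - l mod int (k n)) = lamp k x n (j - l)"
  by (rule lamp_cong) (simp add: mod_diff_right_eq)

lemma lamp_one [simp]: "n \<ge> 1 \<Longrightarrow> k n > 0 \<Longrightarrow> lamp k \<one>\<^bsub>Delta k\<^esub> n j = (False, 0)"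
  using mod_range[of "k n" j]
  by (simp add: lamp_def Delta_def H_group_def semidirect_product_def isometry_of_one)

lemma lamp_mult:
  assumes x: "x \<in> carrier (Delta k)" and y: "y \<in> carrier (Delta k)" and n: "n \<ge> 1" and k: "k n > 0"
  shows "lamp k (x \<otimes>\<^bsub>Delta k\<^esub> y) n j = isometry_mult (lamp k x n j) (lamp k y n (j - shift x n))"
proof -
  have r: "1 \<le> i mod int (k n) + 1" "i mod int (k n) + 1 \<le> int (k n)" for i
    using mod_range[OF k, of i] by simp_all
  then have ri: "i mod int (k n) + 1 \<in> {1..int (k n)}" for i by auto
  have D: "fst (snd z n) (i mod int (k n) + 1) \<in> carrier Dinf" if "z \<in> carrier (Delta k)" for z i
  proof -
    have "fst (snd z n) \<in> (\<Pi>\<^sub>E j\<in>{1..int (k n)}. carrier Dinf)" using that n by (simp add: mem_Delta_iff)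
    then show ?thesis using ri by (rule PiE_mem)
  qed
  have "fst (snd (x \<otimes>\<^bsub>Delta k\<^esub> y) n) (j mod int (k n) + 1) =
      fst (snd x n) (j mod int (k n) + 1) \<otimes>\<^bsub>Dinf\<^esub> fst (snd y n) ((j - shift x n) mod int (k n) + 1)"
    unfolding snd_mult[OF n]
    using r[of j]
    by (simp add: H_group_def semidirect_product_def case_prod_beta cyclic_shift_def mod_diff_left_eq)
  then show ?thesis using D[OF x] D[OF y] by (simp add: lamp_def isometry_of_mult)
qed

lemma Delta_eqI:
  assumes x: "x \<in> carrier (Delta k)" and y: "y \<in> carrier (Delta k)"
    and "fst x = fst y"
    and sh: "\<And>n. n \<ge> 1 \<Longrightarrow> shift x n = shift y n"
    and la: "\<And>n j. n \<ge> 1 \<Longrightarrow> lamp k x n j = lamp k y n j"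
  shows "x = y"
proof -
  have "snd x n = snd y n" for n
  proof (cases "n \<ge> 1")
    case n: True
    have ex: "fst (snd x n) \<in> (\<Pi>\<^sub>E j\<in>{1..int (k n)}. carrier Dinf)"
      and ey: "fst (snd y n) \<in> (\<Pi>\<^sub>E j\<in>{1..int (k n)}. carrier Dinf)"
      using x y n by (simp_all add: mem_Delta_iff)
    have "fst (snd x n) = fst (snd y n)"
    proof (rule PiE_ext[OF ex ey])
      fix i assume i: "i \<in> {1..int (k n)}"
      then have "(i - 1) mod int (k n) + 1 = i" by simp
      then have "isometry_of (fst (snd x n) i) = isometry_of (fst (snd y n) i)"
        using la[OF n, of "i - 1"] by (simp add: lamp_def)
      then show "fst (snd x n) i = fst (snd y n) i"
        using PiE_mem[OF ex i] PiE_mem[OF ey i] isometry_of_bij by (auto simp: bij_betw_def inj_on_def)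
    qed
    then show ?thesis using sh[OF n] by (rule prod_eqI)
  next
    case False
    then show ?thesis using x y by (simp add: mem_Delta_iff extensional_def)
  qed
  then have "snd x = snd y" by (rule ext)
  with \<open>fst x = fst y\<close> show ?thesis by (rule prod_eqI)
qed

section \<open>The generated group\<close>

text \<open>The set \<open>F\<close> consists of the entries that occur an odd number of times in \<open>L\<close>.\<close>

lemma toggle_set_of_list:
  "\<exists>F. finite F \<and> (\<forall>P. odd (length (filter P L)) = odd (card {i \<in> F. P i}))"
proof (induction L)
  case Nil
  show ?case by (rule exI[of _ "{}"]) simp
next
  case (Cons a L)
  then obtain F where F: "finite F" "\<And>P. odd (length (filter P L)) = odd (card {i \<in> F. P i})" by blast
  show ?case
  proof (cases "a \<in> F")
    case True
    have "odd (length (filter P (a # L))) = odd (card {i \<in> F - {a}. P i})" for P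
    proof -
      have "{i \<in> F - {a}. P i} = {i \<in> F. P i} - {a}" by blast
      moreover have "P a \<Longrightarrow> card {i \<in> F. P i} = Suc (card ({i \<in> F. P i} - {a}))"
        using F(1) True by (intro card.remove) auto
      ultimately show ?thesis using F(2)[of P] by (cases "P a") auto
    qed
    then show ?thesis using F(1) by (intro exI[of _ "F - {a}"]) blast
  next
    case False
    have "odd (length (filter P (a # L))) = odd (card {i \<in> insert a F. P i})" for P
    proof -
      have "{i \<in> insert a F. P i} = (if P a then insert a {i \<in> F. P i} else {i \<in> F. P i})" by auto
      then show ?thesis using F False by simp
    qed
    then show ?thesis using F(1) by (intro exI[of _ "insert a F"]) blast
  qed
qed

text \<open>At level \<open>n\<close> the generator \<open>s\<close> has \<open>a\<close> at position \<open>0\<close> and \<open>b\<close> at position \<open>n\<close>. By the bound on \<open>k n\<close>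
  none of the numbers from \<open>1\<close> to \<open>2 n + 1\<close> is a multiple of \<open>k n\<close>, and the numbers \<open>k n\<close> are unbounded.\<close>

locale dihedral_lamps =
  fixes k d :: "nat \<Rightarrow> nat" and \<sigma> :: int
  assumes d: "n \<ge> 1 \<Longrightarrow> d n = n + 1"
    and k_ge: "n \<ge> 1 \<Longrightarrow> k n \<ge> 2 * (n + 1)"
    and odd_\<sigma>: "odd \<sigma>"
begin

abbreviation "S \<equiv> elem_s \<sigma> d k"
abbreviation "T \<equiv> elem_t k"
abbreviation "\<Gamma> \<equiv> G_group \<sigma> d k"

lemma k_pos: "n \<ge> 1 \<Longrightarrow> k n > 0"
  using k_ge[of n] by simp

sublocale D: group "Delta k"
  by (rule group_Delta) (rule k_pos)

lemma gens_in_Delta: "S \<in> carrier (Delta k)" "T \<in> carrier (Delta k)"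
proof -
  have one: "\<one>\<^bsub>Dinf\<^esub> \<in> carrier Dinf" using group_Dinf by (simp add: group.is_monoid)
  show "S \<in> carrier (Delta k)"
    unfolding mem_Delta_iff
    by (auto simp: elem_s_def sigma_def gens_in_Dinf one integer_mod_group_0)
  have "1 \<in> carrier (integer_mod_group (k n))" if "n \<ge> 1" for n
    using k_ge[OF that] by simp
  then show "T \<in> carrier (Delta k)"
    unfolding mem_Delta_iff by (auto simp: elem_t_def one)
qed

lemma carrier_\<Gamma>: "carrier \<Gamma> = generate (Delta k) {S, T}"
  and mult_\<Gamma> [simp]: "monoid.mult \<Gamma> = monoid.mult (Delta k)"
  and one_\<Gamma> [simp]: "\<one>\<^bsub>\<Gamma>\<^esub> = \<one>\<^bsub>Delta k\<^esub>"
  by (simp_all add: G_group_def)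

lemma subgroup_\<Gamma>: "subgroup (generate (Delta k) {S, T}) (Delta k)"
  by (rule D.generate_is_subgroup) (use gens_in_Delta in auto)

lemma group_\<Gamma>: "group \<Gamma>"
  unfolding G_group_def by (rule D.subgroup_imp_group[OF subgroup_\<Gamma>])

lemma \<Gamma>_Delta: "x \<in> carrier \<Gamma> \<Longrightarrow> x \<in> carrier (Delta k)"
  unfolding carrier_\<Gamma> using subgroup.subset[OF subgroup_\<Gamma>] by blast

lemma gens_in_\<Gamma>: "S \<in> carrier \<Gamma>" "T \<in> carrier \<Gamma>"
  unfolding carrier_\<Gamma> by (auto intro: generate.incl)

lemma finitely_generated_\<Gamma>: "finitely_generated \<Gamma>"
proof -
  have "generate \<Gamma> {S, T} = carrier \<Gamma>"
    using D.generate_consistent[OF _ subgroup_\<Gamma>, of "{S, T}"]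
    by (simp add: G_group_def generate.incl)
  then show ?thesis unfolding finitely_generated_def using gens_in_\<Gamma> by (intro exI[of _ "{S, T}"]) auto
qed

lemma lamp_S:
  assumes n: "n \<ge> 1"
  shows "lamp k S n j = (if int (k n) dvd j then (True, 0)
     else if int (k n) dvd j - int n then (True, 1) else (False, 0))"
proof -
  have kn: "int n < int (k n)" "k n > 0" using k_ge[OF n] by auto
  have "j mod int (k n) = int n \<longleftrightarrow> int (k n) dvd j - int n"
    using kn mod_eq_dvd_iff[of j "int (k n)" "int n"] by simp
  moreover have "j mod int (k n) = 0 \<longleftrightarrow> int (k n) dvd j" by (simp add: dvd_eq_mod_eq_0)
  moreover have "0 \<le> j mod int (k n)" "j mod int (k n) + 1 \<le> int (k n)"
    using mod_range[of "k n" j] kn by auto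
  ultimately show ?thesis
    using n kn by (simp add: lamp_def elem_s_def sigma_def d isometry_of_gens isometry_of_one)
qed

lemma fst_S: "fst S = \<sigma>" and fst_T: "fst T = 0"
  by (simp_all add: elem_s_def elem_t_def)

lemma shift_S: "n \<ge> 1 \<Longrightarrow> shift S n = 0"
  by (simp add: elem_s_def)

lemma shift_T: "n \<ge> 1 \<Longrightarrow> shift T n = 1"
  by (simp add: elem_t_def)

lemma lamp_T: "n \<ge> 1 \<Longrightarrow> lamp k T n j = (False, 0)"
  using mod_range[OF k_pos, of n j] by (simp add: lamp_def elem_t_def isometry_of_one)

lemma lamp_mult_of_degree:
  assumes "x \<in> carrier (Delta k)" "y \<in> carrier (Delta k)" "n \<ge> 1" "shift x n = l mod int (k n)"
  shows "lamp k (x \<otimes>\<^bsub>Delta k\<^esub> y) n j = isometry_mult (lamp k x n j) (lamp k y n (j - l))"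
  unfolding lamp_mult[OF assms(1-3) k_pos[OF assms(3)]] assms(4) lamp_shift_mod ..

text \<open>The exponent sum of \<open>t\<close>. A single level shows it only modulo \<open>k n\<close>; all levels together determine it.\<close>

definition degree_is :: "ambient \<Rightarrow> int \<Rightarrow> bool" where
  "degree_is x l \<longleftrightarrow> (\<forall>n\<ge>1. shift x n = l mod int (k n))"

lemma degree_zero_iff: "degree_is x 0 \<longleftrightarrow> (\<forall>n\<ge>1. shift x n = 0)"
  by (simp add: degree_is_def)

lemma degree_T: "degree_is T 1" and degree_S: "degree_is S 0"
  using k_ge by (force simp: degree_is_def shift_T shift_S)+

lemma degree_mult:
  "degree_is x l \<Longrightarrow> degree_is y m \<Longrightarrow> degree_is (x \<otimes>\<^bsub>Delta k\<^esub> y) (l + m)"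
  by (simp add: degree_is_def mod_add_eq)

lemma degree_left_inverse:
  assumes y: "y \<in> carrier (Delta k)" and x: "degree_is x l" and yx: "degree_is (y \<otimes>\<^bsub>Delta k\<^esub> x) m"
  shows "degree_is y (m - l)"
  unfolding degree_is_def
proof (intro allI impI)
  fix n :: nat assume n: "n \<ge> 1"
  have "shift y n \<in> carrier (integer_mod_group (k n))"
    using y n unfolding mem_Delta_iff by blast
  then have "shift y n mod int (k n) = shift y n"
    using k_pos[OF n] by (simp add: carrier_integer_mod_group)
  moreover have "(shift y n + l) mod int (k n) = m mod int (k n)"
    using x yx n by (simp add: degree_is_def mod_add_right_eq)
  then have "(m - l) mod int (k n) = (shift y n + l - l) mod int (k n)"
    by (metis mod_diff_left_eq)
  ultimately show "shift y n = (m - l) mod int (k n)" by simp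
qed

text \<open>For the letters \<open>a\<close> at level \<open>n\<close> of a product of conjugates \<open>t\<^sup>i s t\<^sup>-\<^sup>i\<close> with \<open>i\<close> running over \<open>L\<close>, the
  parity of their number in coordinate \<open>j\<close>. The letters \<open>b\<close> sit \<open>n\<close> positions further.\<close>

definition parity_at :: "nat \<Rightarrow> int list \<Rightarrow> int \<Rightarrow> bool" where
  "parity_at n L j = odd (length (filter (\<lambda>i. int (k n) dvd j - i) L))"

lemma parity_at_translate: "parity_at n (map (\<lambda>i. i + l) L) j = parity_at n L (j - l)"
  by (simp add: parity_at_def filter_map o_def algebra_simps)

lemma parity_at_append: "parity_at n (L @ M) j = (parity_at n L j \<noteq> parity_at n M j)"
  by (simp add: parity_at_def)

text \<open>The entries of \<open>L\<close> are the positions of the conjugates of \<open>s\<close> and \<open>s\<^sup>-\<^sup>1\<close> in a word for \<open>x\<close>. Signs are not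
  recorded, so only parities are compared; the integer component has the parity of the length because
  \<open>\<sigma>\<close> is odd.\<close>

definition toggles :: "ambient \<Rightarrow> int list \<Rightarrow> bool" where
  "toggles x L \<longleftrightarrow> even (fst x) = even (length L) \<and>
     (\<forall>n\<ge>1. \<forall>j. reflects_a (lamp k x n j) = parity_at n L j \<and>
                reflects_b (lamp k x n j) = parity_at n L (j - int n))"

text \<open>This property is not implied by the parities: a coordinate of even parities may be any even translation.\<close>

definition tame :: "ambient \<Rightarrow> bool" where
  "tame x \<longleftrightarrow> (\<exists>N. \<forall>n>N. \<forall>j. lamp k x n j \<in> standard)"

lemma toggles_mult:
  assumes x: "x \<in> carrier (Delta k)" and y: "y \<in> carrier (Delta k)"
    and "toggles x L" "toggles y M" "degree_is x l"
  shows "toggles (x \<otimes>\<^bsub>Delta k\<^esub> y) (L @ map (\<lambda>i. i + l) M)"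
proof -
  have swap: "j - l - int n = j - int n - l" for j n by simp
  have t: "reflects_a (lamp k z n j) = parity_at n K j" "reflects_b (lamp k z n j) = parity_at n K (j - int n)"
    if "toggles z K" "n \<ge> 1" for z K n j
    using that by (simp_all add: toggles_def)
  have "lamp k (x \<otimes>\<^bsub>Delta k\<^esub> y) n j = isometry_mult (lamp k x n j) (lamp k y n (j - l))" if "n \<ge> 1" for n j
    using lamp_mult_of_degree[OF x y that, of l] assms(5) that by (simp add: degree_is_def)
  then have "reflects_a (lamp k (x \<otimes>\<^bsub>Delta k\<^esub> y) n j) = parity_at n (L @ map (\<lambda>i. i + l) M) j"
    "reflects_b (lamp k (x \<otimes>\<^bsub>Delta k\<^esub> y) n j) = parity_at n (L @ map (\<lambda>i. i + l) M) (j - int n)"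
    if "n \<ge> 1" for n j
    using that by (simp_all only: reflects_isometry_mult parity_at_append parity_at_translate t[OF assms(3)] t[OF assms(4)] swap)
  moreover have "even (fst (x \<otimes>\<^bsub>Delta k\<^esub> y)) = even (length (L @ map (\<lambda>i. i + l) M))"
    using assms(3,4) by (simp add: toggles_def)
  ultimately show ?thesis unfolding toggles_def by blast
qed

lemma toggles_inverse:
  assumes x: "x \<in> carrier (Delta k)" and y: "y \<in> carrier (Delta k)"
    and yx: "y \<otimes>\<^bsub>Delta k\<^esub> x = \<one>\<^bsub>Delta k\<^esub>" and L: "toggles x L" and l: "degree_is x l"
  shows "toggles y (map (\<lambda>i. i - l) L)" "n \<ge> 1 \<Longrightarrow> isometry_mult (lamp k y n j) (lamp k x n (j + l)) = (False, 0)"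
    "degree_is y (- l)"
proof -
  have "degree_is (y \<otimes>\<^bsub>Delta k\<^esub> x) 0" unfolding yx by (simp add: degree_is_def)
  from degree_left_inverse[OF y l this] show dy: "degree_is y (- l)" by simp
  have la: "isometry_mult (lamp k y n j) (lamp k x n (j + l)) = (False, 0)" if "n \<ge> 1" for n j
    using lamp_mult_of_degree[OF y x that, of "- l" j] dy that k_pos[OF that] yx by (simp add: degree_is_def)
  then show "n \<ge> 1 \<Longrightarrow> isometry_mult (lamp k y n j) (lamp k x n (j + l)) = (False, 0)" .
  have "reflects_a (lamp k y n j) = reflects_a (lamp k x n (j + l))"
    "reflects_b (lamp k y n j) = reflects_b (lamp k x n (j + l))" if "n \<ge> 1" for n j
    using la[OF that, of j] reflects_isometry_mult[of "lamp k y n j" "lamp k x n (j + l)"]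
    by (simp_all add: reflects_a_def reflects_b_def)
  moreover have "fst y + fst x = 0" using yx by (metis fst_mult fst_one)
  then have "even (fst y) = even (fst x)" by presburger
  moreover have "parity_at n (map (\<lambda>i. i - l) L) j = parity_at n L (j + l)" for n j
    using parity_at_translate[of n "- l" L j] by simp
  moreover have "j + l - int n = j - int n + l" for j n by simp
  ultimately show "toggles y (map (\<lambda>i. i - l) L)"
    using L unfolding toggles_def by simp
qed

text \<open>Coordinates both of whose parities are odd die out for large levels.\<close>

text \<open>If both parities are odd at \<open>j\<close>, then there are entries \<open>p\<close> and \<open>q\<close> of \<open>L\<close> with \<open>p\<close> and \<open>q + n\<close> both congruent
  to \<open>j\<close>. So \<open>k n\<close> divides \<open>n + q - p\<close>, which lies strictly between \<open>0\<close> and \<open>2 n\<close> as soon as \<open>n\<close> exceeds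
  twice the bound \<open>r\<close> for the entries.\<close>

lemma toggles_not_both:
  assumes L: "toggles x L"
  obtains N where "\<And>n j. n > N \<Longrightarrow> \<not> (reflects_a (lamp k x n j) \<and> reflects_b (lamp k x n j))"
proof -
  define r where "r = Max (insert 0 (abs ` set L))"
  have r: "\<bar>i\<bar> \<le> r" if "i \<in> set L" for i using that by (simp add: r_def)
  have r0: "r \<ge> 0" by (simp add: r_def)
  have "\<not> (reflects_a (lamp k x n j) \<and> reflects_b (lamp k x n j))" if n: "n > nat (2 * r)" for n j
  proof
    assume "reflects_a (lamp k x n j) \<and> reflects_b (lamp k x n j)"
    then have "odd (length (filter (\<lambda>i. int (k n) dvd j - i) L))"
      "odd (length (filter (\<lambda>i. int (k n) dvd j - int n - i) L))"
      using L n unfolding toggles_def parity_at_def by auto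
    then have "filter (\<lambda>i. int (k n) dvd j - i) L \<noteq> []" "filter (\<lambda>i. int (k n) dvd j - int n - i) L \<noteq> []"
      by auto
    then obtain p q where p: "p \<in> set L" "int (k n) dvd j - p" and q: "q \<in> set L" "int (k n) dvd j - int n - q"
      by (auto simp: filter_empty_conv)
    have "int (k n) dvd (j - p) - (j - int n - q)" by (rule dvd_diff[OF p(2) q(2)])
    then have dv: "int (k n) dvd int n + q - p" by (simp add: algebra_simps)
    have "int n > 2 * r" using n by linarith
    then have "0 < int n + q - p" "int n + q - p < 2 * int n" using r[OF p(1)] r[OF q(1)] by auto
    moreover have "2 * int n < int (k n)" using k_ge[of n] n by simp
    ultimately show False using zdvd_imp_le[OF dv] by linarith
  qed
  then show ?thesis using that by blast
qed

text \<open>A product of two of \<open>1\<close>, \<open>a\<close> and \<open>b\<close> is again one of them unless it is \<open>a b\<close> or \<open>b a\<close>, and these have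
  both parities odd.\<close>

lemma tame_mult:
  assumes x: "x \<in> carrier (Delta k)" and y: "y \<in> carrier (Delta k)"
    and "tame x" "tame y" and L: "toggles (x \<otimes>\<^bsub>Delta k\<^esub> y) L"
  shows "tame (x \<otimes>\<^bsub>Delta k\<^esub> y)"
proof -
  obtain N1 where N1: "\<And>n j. n > N1 \<Longrightarrow> lamp k x n j \<in> standard"
    using \<open>tame x\<close> by (auto simp: tame_def)
  obtain N2 where N2: "\<And>n j. n > N2 \<Longrightarrow> lamp k y n j \<in> standard"
    using \<open>tame y\<close> by (auto simp: tame_def)
  obtain N3 where N3: "\<And>n j. n > N3 \<Longrightarrow>
      \<not> (reflects_a (lamp k (x \<otimes>\<^bsub>Delta k\<^esub> y) n j) \<and> reflects_b (lamp k (x \<otimes>\<^bsub>Delta k\<^esub> y) n j))"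
    using toggles_not_both[OF L] by blast
  have std: "isometry_mult u v \<in> standard"
    if "u \<in> standard" "v \<in> standard" "\<not> (reflects_a (isometry_mult u v) \<and> reflects_b (isometry_mult u v))" for u v
    using that by (auto simp: standard_def isometry_mult_def reflects_a_def reflects_b_def)
  have "lamp k (x \<otimes>\<^bsub>Delta k\<^esub> y) n j \<in> standard" if "n > N1 + N2 + N3" for n j
  proof -
    have n: "n \<ge> 1" "n > N1" "n > N2" "n > N3" using that by auto
    show ?thesis
      using N1[OF n(2)] N2[OF n(3)] N3[OF n(4)]
      unfolding lamp_mult[OF x y n(1) k_pos[OF n(1)]] by (rule std)
  qed
  then show ?thesis unfolding tame_def by blast
qed

lemma tame_inverse:
  assumes "tame x" and yx: "\<And>n j. n \<ge> 1 \<Longrightarrow> isometry_mult (lamp k y n j) (lamp k x n (j + l)) = (False, 0)"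
  shows "tame y"
proof -
  obtain N where N: "\<And>n j. n > N \<Longrightarrow> lamp k x n j \<in> standard"
    using \<open>tame x\<close> by (auto simp: tame_def)
  have inv: "u \<in> standard" if "v \<in> standard" "isometry_mult u v = (False, 0)" for u v
    using that by (cases u) (auto simp: standard_def isometry_mult_def split: if_splits)
  have "lamp k y n j \<in> standard" if "n > N" for n j
    using inv[OF N[OF that] yx] that by simp
  then show ?thesis unfolding tame_def by blast
qed

lemma gen_tracked:
  assumes "x \<in> {S, T}"
  shows "\<exists>L l. toggles x L \<and> degree_is x l \<and> tame x"
proof -
  have "\<not> (int (k n) dvd j \<and> int (k n) dvd j - int n)" if "n \<ge> 1" for n j
  proof
    assume "int (k n) dvd j \<and> int (k n) dvd j - int n"
    then have "int (k n) dvd j - (j - int n)" using dvd_diff by blast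
    then have "int (k n) dvd int n" by simp
    then show False using zdvd_imp_le[of "int (k n)" "int n"] k_ge[OF that] that by simp
  qed
  then have "toggles S [0]"
    using odd_\<sigma> by (auto simp: toggles_def parity_at_def lamp_S reflects_a_def reflects_b_def fst_S)
  moreover have "tame S"
    unfolding tame_def by (rule exI[of _ 0]) (auto simp: lamp_S standard_def)
  moreover have "toggles T []"
    by (auto simp: toggles_def parity_at_def lamp_T reflects_a_def reflects_b_def fst_T)
  moreover have "tame T"
    unfolding tame_def by (rule exI[of _ 0]) (auto simp: lamp_T standard_def)
  ultimately show ?thesis using assms degree_S degree_T by blast
qed

lemma \<Gamma>_tracked:
  assumes "x \<in> carrier \<Gamma>"
  shows "\<exists>L l. toggles x L \<and> degree_is x l \<and> tame x"
  using assms unfolding carrier_\<Gamma>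
proof induction
  case one
  have "toggles \<one>\<^bsub>Delta k\<^esub> []" "degree_is \<one>\<^bsub>Delta k\<^esub> 0" "tame \<one>\<^bsub>Delta k\<^esub>"
    by (auto simp: toggles_def parity_at_def degree_is_def tame_def standard_def reflects_a_def reflects_b_def k_pos
        intro!: exI[of _ 0])
  then show ?case by blast
next
  case (incl x)
  then show ?case using gen_tracked by blast
next
  case (inv x)
  then obtain L l where x: "x \<in> carrier (Delta k)" "toggles x L" "degree_is x l" "tame x"
    using gen_tracked gens_in_Delta by blast
  have y: "inv\<^bsub>Delta k\<^esub> x \<in> carrier (Delta k)" "inv\<^bsub>Delta k\<^esub> x \<otimes>\<^bsub>Delta k\<^esub> x = \<one>\<^bsub>Delta k\<^esub>"
    using x by simp_all
  note ti = toggles_inverse[OF x(1) y x(2,3)]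
  show ?case using ti(1,3) tame_inverse[OF x(4) ti(2)] by blast
next
  case (eng x y)
  then obtain L l M m where *: "toggles x L" "degree_is x l" "tame x" "toggles y M" "degree_is y m" "tame y"
    by blast
  have c: "x \<in> carrier (Delta k)" "y \<in> carrier (Delta k)"
    using eng subgroup.subset[OF subgroup_\<Gamma>] by blast+
  note t = toggles_mult[OF c *(1,4,2)]
  show ?case using t degree_mult[OF *(2,5)] tame_mult[OF c *(3,6) t] by blast
qed

section \<open>Torsion-freeness\<close>

lemma inv_\<Gamma>: "x \<in> carrier \<Gamma> \<Longrightarrow> inv\<^bsub>\<Gamma>\<^esub> x = inv\<^bsub>Delta k\<^esub> x"
  using D.m_inv_consistent[OF subgroup_\<Gamma>, of x] by (simp add: G_group_def)

lemma nat_pow_\<Gamma>: "x [^]\<^bsub>\<Gamma>\<^esub> (n::nat) = x [^]\<^bsub>Delta k\<^esub> n"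
  unfolding G_group_def by (rule D.nat_pow_consistent[symmetric])

lemma int_pow_\<Gamma>: "x \<in> carrier \<Gamma> \<Longrightarrow> x [^]\<^bsub>\<Gamma>\<^esub> (p::int) = x [^]\<^bsub>Delta k\<^esub> p"
  using D.int_pow_consistent[OF subgroup_\<Gamma>, of x p] by (simp add: G_group_def)

lemma \<Gamma>_closed:
  "x \<in> carrier \<Gamma> \<Longrightarrow> y \<in> carrier \<Gamma> \<Longrightarrow> x \<otimes>\<^bsub>Delta k\<^esub> y \<in> carrier \<Gamma>"
  "x \<in> carrier \<Gamma> \<Longrightarrow> inv\<^bsub>Delta k\<^esub> x \<in> carrier \<Gamma>"
  "\<one>\<^bsub>Delta k\<^esub> \<in> carrier \<Gamma>"
  "x \<in> carrier \<Gamma> \<Longrightarrow> x [^]\<^bsub>Delta k\<^esub> (p::int) \<in> carrier \<Gamma>"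
  "x \<in> carrier \<Gamma> \<Longrightarrow> x [^]\<^bsub>Delta k\<^esub> (n::nat) \<in> carrier \<Gamma>"
proof -
  interpret G: group \<Gamma> by (rule group_\<Gamma>)
  show "x \<in> carrier \<Gamma> \<Longrightarrow> y \<in> carrier \<Gamma> \<Longrightarrow> x \<otimes>\<^bsub>Delta k\<^esub> y \<in> carrier \<Gamma>"
    using G.m_closed[of x y] by simp
  show "x \<in> carrier \<Gamma> \<Longrightarrow> inv\<^bsub>Delta k\<^esub> x \<in> carrier \<Gamma>"
    using G.inv_closed[of x] by (simp add: inv_\<Gamma>)
  show "\<one>\<^bsub>Delta k\<^esub> \<in> carrier \<Gamma>" using G.one_closed by simp
  show "x \<in> carrier \<Gamma> \<Longrightarrow> x [^]\<^bsub>Delta k\<^esub> (p::int) \<in> carrier \<Gamma>"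
    using G.int_pow_closed[of x p] by (simp add: int_pow_\<Gamma>)
  show "x \<in> carrier \<Gamma> \<Longrightarrow> x [^]\<^bsub>Delta k\<^esub> (n::nat) \<in> carrier \<Gamma>"
    using G.nat_pow_closed[of x n] by (simp add: nat_pow_\<Gamma>)
qed

lemma degree_one: "degree_is \<one>\<^bsub>Delta k\<^esub> 0"
  by (simp add: degree_is_def)

lemma degree_inv:
  assumes "x \<in> carrier (Delta k)" "degree_is x l"
  shows "degree_is (inv\<^bsub>Delta k\<^esub> x) (- l)"
  using degree_left_inverse[of "inv\<^bsub>Delta k\<^esub> x" x l 0] assms degree_one by simp

lemma degree_nat_pow:
  assumes "x \<in> carrier (Delta k)" "degree_is x l"
  shows "degree_is (x [^]\<^bsub>Delta k\<^esub> (n::nat)) (int n * l)"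
proof (induction n)
  case (Suc n)
  then show ?case using degree_mult[OF Suc assms(2)] by (simp add: algebra_simps)
qed (simp add: degree_one)

lemma degree_int_pow:
  assumes "x \<in> carrier (Delta k)" "degree_is x l"
  shows "degree_is (x [^]\<^bsub>Delta k\<^esub> (p::int)) (p * l)"
proof (cases p rule: int_cases2)
  case (nonneg n)
  then show ?thesis using degree_nat_pow[OF assms, of n] by (simp add: int_pow_int)
next
  case (nonpos n)
  then show ?thesis
    using degree_inv[OF _ degree_nat_pow[OF assms, of n]] assms(1) by (simp add: D.int_pow_neg_int)
qed

lemma lamp_mult_base:
  assumes "x \<in> carrier (Delta k)" "y \<in> carrier (Delta k)" "degree_is x 0" "n \<ge> 1"
  shows "lamp k (x \<otimes>\<^bsub>Delta k\<^esub> y) n j = isometry_mult (lamp k x n j) (lamp k y n j)"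
  using lamp_mult_of_degree[OF assms(1,2,4), of 0 j] assms(3,4) by (simp add: degree_is_def)

lemma lamp_inv_base:
  assumes "x \<in> carrier (Delta k)" "degree_is x 0" "n \<ge> 1"
  shows "isometry_mult (lamp k (inv\<^bsub>Delta k\<^esub> x) n j) (lamp k x n j) = (False, 0)"
  using lamp_mult_base[of "inv\<^bsub>Delta k\<^esub> x" x n j] degree_inv[of x 0] assms k_pos[OF assms(3)] by simp

lemma lamp_pow_base:
  assumes "x \<in> carrier (Delta k)" "degree_is x 0" "n \<ge> 1"
  shows "lamp k (x [^]\<^bsub>Delta k\<^esub> (m::nat)) n j = (isometry_mult (lamp k x n j) ^^ m) (False, 0)"
proof (induction m)
  case (Suc m)
  have "x [^]\<^bsub>Delta k\<^esub> Suc m = x \<otimes>\<^bsub>Delta k\<^esub> x [^]\<^bsub>Delta k\<^esub> m"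
    using assms(1) by (rule D.nat_pow_Suc2)
  then show ?case using lamp_mult_base[OF assms(1) _ assms(2,3), of "x [^]\<^bsub>Delta k\<^esub> m" j] Suc assms(1) by simp
qed (use assms(3) k_pos[OF assms(3)] in simp)

lemma fst_pow: "fst (x [^]\<^bsub>Delta k\<^esub> (n::nat)) = int n * fst x"
  by (induction n) (simp_all add: algebra_simps)

text \<open>Otherwise the smallest element \<open>p\<close> and the largest element \<open>q\<close> of \<open>F\<close> are different. At level
  \<open>n = q - p\<close> the coordinate \<open>q\<close> receives the letter \<open>a\<close> from \<open>q\<close>, the letter \<open>b\<close> from \<open>p\<close>, and no others, as
  the elements of \<open>F\<close> are pairwise incongruent modulo \<open>k n\<close>.\<close>

lemma toggle_set_empty:
  assumes F: "finite F" "\<And>P. odd (length (filter P L)) = odd (card {i \<in> F. P i})"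
    and even: "even (length L)"
    and not_both: "\<And>n j. n \<ge> 1 \<Longrightarrow> \<not> (parity_at n L j \<and> parity_at n L (j - int n))"
  shows "F = {}"
proof (rule ccontr)
  assume ne: "F \<noteq> {}"
  define p where "p = Min F"
  define q where "q = Max F"
  have pq: "p \<in> F" "q \<in> F" "\<And>i. i \<in> F \<Longrightarrow> p \<le> i \<and> i \<le> q"
    using F(1) ne by (simp_all add: p_def q_def)
  have "even (card F)" using F(2)[of "\<lambda>_. True"] even by simp
  then have "p \<noteq> q"
  proof (rule contrapos_pn)
    assume "p = q"
    then have "F = {p}" using pq by force
    then show "odd (card F)" by simp
  qed
  then have lt: "p < q" using pq(3)[OF pq(1)] by simp
  define n where "n = nat (q - p)"
  have n: "n \<ge> 1" "int n = q - p" using lt by (auto simp: n_def)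
  have close: "int (k n) dvd i - j \<Longrightarrow> i = j" if "i \<in> F" "j \<in> F" for i j
  proof (rule ccontr)
    assume "int (k n) dvd i - j" "i \<noteq> j"
    then have "int (k n) \<le> \<bar>i - j\<bar>" using dvd_imp_le_int[of "i - j" "int (k n)"] by simp
    moreover have "int n < int (k n)" using k_ge[OF n(1)] by simp
    ultimately show False using pq(3)[OF that(1)] pq(3)[OF that(2)] n(2) by linarith
  qed
  have "{i \<in> F. int (k n) dvd q - i} = {q}" using pq(2) close by auto
  then have "parity_at n L q" unfolding parity_at_def F(2) by simp
  moreover have "{i \<in> F. int (k n) dvd p - i} = {p}" using pq(1) close by auto
  then have "parity_at n L p" unfolding parity_at_def F(2) by simp
  ultimately show False using not_both[OF n(1), of q] n(2) by simp
qed

text \<open>A torsion element has degree zero and integer component zero, so it toggles an even number of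
  positions, and all its coordinates have finite order. A coordinate with two equal parities is a
  translation and therefore trivial. So the parities are never both odd, no position is toggled an
  odd number of times, all parities are even, and all coordinates are trivial.\<close>

theorem torsion_free_\<Gamma>: "torsion_free \<Gamma>"
  unfolding torsion_free_def
proof (intro ballI allI impI)
  fix x and N :: nat
  assume x: "x \<in> carrier \<Gamma>" and N: "N > 0" and "x [^]\<^bsub>\<Gamma>\<^esub> N = \<one>\<^bsub>\<Gamma>\<^esub>"
  then have xN: "x [^]\<^bsub>Delta k\<^esub> N = \<one>\<^bsub>Delta k\<^esub>" by (simp add: nat_pow_\<Gamma>)
  have xD: "x \<in> carrier (Delta k)" using x by (rule \<Gamma>_Delta)
  obtain L l where L: "toggles x L" and l: "degree_is x l" using \<Gamma>_tracked[OF x] by blast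
  have "l = 0"
  proof -
    \<comment> \<open>a level at which \<open>k n\<close> exceeds the degree of the power \<open>x\<^sup>N\<close>\<close>
    define n where "n = nat \<bar>int N * l\<bar> + 1"
    have n: "n \<ge> 1" by (simp add: n_def)
    have "degree_is \<one>\<^bsub>Delta k\<^esub> (int N * l)" using degree_nat_pow[OF xD l, of N] xN by simp
    then have "int (k n) dvd int N * l" using n by (auto simp: degree_is_def dvd_eq_mod_eq_0)
    moreover have "\<bar>int N * l\<bar> < int (k n)" using k_ge[OF n] by (simp add: n_def)
    ultimately have "int N * l = 0" using dvd_imp_le_int[of "int N * l" "int (k n)"] by fastforce
    then show "l = 0" using N by simp
  qed
  with l have x0: "degree_is x 0" by simp
  have "int N * fst x = 0" using xN fst_pow[of x N] by simp
  then have fx: "fst x = 0" using N by simp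
  have trivial: "lamp k x n j = (False, 0)"
    if n: "n \<ge> 1" and eq: "reflects_a (lamp k x n j) = reflects_b (lamp k x n j)" for n j
  proof -
    obtain m where v: "lamp k x n j = (False, m)"
      using eq by (cases "lamp k x n j") (auto simp: reflects_a_def reflects_b_def)
    have "(isometry_mult (False, m) ^^ N) (False, 0) = (False, 0)"
      using lamp_pow_base[OF xD x0 n, of N j] n k_pos[OF n] unfolding xN v by simp
    then show ?thesis using N v by (simp add: pow_rotation)
  qed
  obtain F where F: "finite F" "\<And>P. odd (length (filter P L)) = odd (card {i \<in> F. P i})"
    using toggle_set_of_list[of L] by blast
  have "F = {}"
  proof (rule toggle_set_empty[OF F])
    show "even (length L)" using L fx by (simp add: toggles_def)
    show "\<not> (parity_at n L j \<and> parity_at n L (j - int n))" if n: "n \<ge> 1" for n j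
    proof
      assume "parity_at n L j \<and> parity_at n L (j - int n)"
      then have *: "reflects_a (lamp k x n j)" "reflects_b (lamp k x n j)"
        using L n by (auto simp: toggles_def)
      with trivial[OF n, of j] show False by (simp add: reflects_b_def)
    qed
  qed
  then have "\<not> parity_at n L j" for n j unfolding parity_at_def F(2) by simp
  then have la: "lamp k x n j = (False, 0)" if "n \<ge> 1" for n j
    using L that trivial[OF that, of j] by (auto simp: toggles_def)
  have "x = \<one>\<^bsub>Delta k\<^esub>"
    by (rule Delta_eqI[OF xD D.one_closed]) (use fx x0 la k_pos in \<open>auto simp: degree_is_def\<close>)
  then show "x = \<one>\<^bsub>\<Gamma>\<^esub>" by simp
qed

section \<open>Conjugates of squares in the base\<close>

definition base :: "ambient set" where
  "base = {x \<in> carrier \<Gamma>. degree_is x 0}"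

lemma base_D: "x \<in> base \<Longrightarrow> x \<in> carrier \<Gamma>" "x \<in> base \<Longrightarrow> x \<in> carrier (Delta k)" "x \<in> base \<Longrightarrow> degree_is x 0"
  by (auto simp: base_def intro: \<Gamma>_Delta)

lemma subgroup_base: "subgroup base \<Gamma>"
proof (rule group.subgroupI[OF group_\<Gamma>])
  have "\<one>\<^bsub>Delta k\<^esub> \<in> base" using \<Gamma>_closed(3) degree_one by (simp add: base_def)
  then show "base \<noteq> {}" by blast
  show "inv\<^bsub>\<Gamma>\<^esub> x \<in> base" if "x \<in> base" for x
    using degree_inv[OF base_D(2,3)[OF that]] base_D(1)[OF that] by (simp add: base_def inv_\<Gamma> \<Gamma>_closed)
  show "x \<otimes>\<^bsub>\<Gamma>\<^esub> y \<in> base" if "x \<in> base" "y \<in> base" for x y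
    using degree_mult[OF base_D(3)[OF that(1)] base_D(3)[OF that(2)]] that[THEN base_D(1)]
    by (simp add: base_def \<Gamma>_closed)
qed (simp add: base_def)

lemma commutator_in_base:
  assumes x: "x \<in> carrier \<Gamma>" and y: "y \<in> carrier \<Gamma>"
  shows "x \<otimes>\<^bsub>\<Gamma>\<^esub> y \<otimes>\<^bsub>\<Gamma>\<^esub> inv\<^bsub>\<Gamma>\<^esub> x \<otimes>\<^bsub>\<Gamma>\<^esub> inv\<^bsub>\<Gamma>\<^esub> y \<in> base"
proof -
  obtain l m where lm: "degree_is x l" "degree_is y m" using \<Gamma>_tracked x y by blast
  note xy = x[THEN \<Gamma>_Delta] y[THEN \<Gamma>_Delta]
  have "degree_is (x \<otimes>\<^bsub>Delta k\<^esub> y \<otimes>\<^bsub>Delta k\<^esub> inv\<^bsub>Delta k\<^esub> x \<otimes>\<^bsub>Delta k\<^esub> inv\<^bsub>Delta k\<^esub> y) (l + m + - l + - m)"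
    by (intro degree_mult degree_inv lm xy)
  then show ?thesis using x y by (simp add: base_def \<Gamma>_closed inv_\<Gamma>)
qed

text \<open>An element of this set is determined by its finitely many coordinates at the levels up to \<open>N\<close>.\<close>

lemma finite_bounded_lamps:
  assumes fin: "\<And>n. finite (V n)" and triv: "\<And>n. n > N \<Longrightarrow> V n \<subseteq> {(False, 0)}"
  shows "finite {y \<in> carrier (Delta k). fst y = c \<and> degree_is y 0 \<and> (\<forall>n\<ge>1. \<forall>j. lamp k y n j \<in> V n)}"
    (is "finite ?Y")
proof -
  define f where "f = (\<lambda>y. restrict (\<lambda>n. restrict (\<lambda>j. lamp k y n j) {0..<int (k n)}) {1..N})"
  have "f ` ?Y \<subseteq> (\<Pi>\<^sub>E n\<in>{1..N}. \<Pi>\<^sub>E j\<in>{0..<int (k n)}. V n)"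
    by (auto simp: f_def)
  moreover have "finite (\<Pi>\<^sub>E n\<in>{1..N}. \<Pi>\<^sub>E j\<in>{0..<int (k n)}. V n)"
    by (intro finite_PiE fin) auto
  ultimately have "finite (f ` ?Y)" by (rule finite_subset)
  moreover have "inj_on f ?Y"
  proof (rule inj_onI)
    fix y z assume y: "y \<in> ?Y" and z: "z \<in> ?Y" and eq: "f y = f z"
    show "y = z"
    proof (rule Delta_eqI)
      fix n :: nat and j :: int assume n: "n \<ge> 1"
      show "lamp k y n j = lamp k z n j"
      proof (cases "n \<le> N")
        case True
        have j: "j mod int (k n) \<in> {0..<int (k n)}" using k_pos[OF n] by simp
        have "f y n (j mod int (k n)) = f z n (j mod int (k n))" using eq by simp
        then have "lamp k y n (j mod int (k n)) = lamp k z n (j mod int (k n))"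
          using True n j by (simp add: f_def)
        then show ?thesis using lamp_cong[of "j mod int (k n)" k n j] by simp
      next
        case False
        have "lamp k y n j \<in> V n" "lamp k z n j \<in> V n" using y z n by simp_all
        moreover have "V n \<subseteq> {(False, 0)}" using False triv[of n] by simp
        ultimately have "lamp k y n j \<in> {(False, 0)}" "lamp k z n j \<in> {(False, 0)}"
          using subsetD by metis+
        then show ?thesis by simp
      qed
    qed (use y z in \<open>auto simp: degree_is_def\<close>)
  qed
  ultimately show ?thesis using finite_imageD by blast
qed

lemma finite_range_lamp: "n \<ge> 1 \<Longrightarrow> finite (range (lamp k x n))"
proof -
  assume n: "n \<ge> 1"
  have "range (lamp k x n) \<subseteq> lamp k x n ` {0..<int (k n)}"
  proof
    fix v assume "v \<in> range (lamp k x n)"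
    then obtain j where "v = lamp k x n j" by blast
    then have "v = lamp k x n (j mod int (k n))" using lamp_cong[of "j mod int (k n)" k n j] by simp
    then show "v \<in> lamp k x n ` {0..<int (k n)}" using k_pos[OF n] by simp
  qed
  then show ?thesis using finite_subset by blast
qed

text \<open>The coordinates are compared in the equation \<open>y g = g w\<close>, which avoids those of the inverse of \<open>g\<close>.\<close>

lemma lamp_conjugate:
  assumes g: "g \<in> carrier (Delta k)" and w: "w \<in> carrier (Delta k)"
    and l: "degree_is g l" and w0: "degree_is w 0"
  defines "y \<equiv> g \<otimes>\<^bsub>Delta k\<^esub> w \<otimes>\<^bsub>Delta k\<^esub> inv\<^bsub>Delta k\<^esub> g"
  shows "y \<in> carrier (Delta k)" "fst y = fst w" "degree_is y 0"
    "n \<ge> 1 \<Longrightarrow> isometry_mult (lamp k y n j) (lamp k g n j) = isometry_mult (lamp k g n j) (lamp k w n (j - l))"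
proof -
  show y: "y \<in> carrier (Delta k)" using g w by (simp add: y_def)
  have yg: "y \<otimes>\<^bsub>Delta k\<^esub> g = g \<otimes>\<^bsub>Delta k\<^esub> w" using g w by (simp add: y_def D.m_assoc)
  then have "fst y + fst g = fst g + fst w" by (metis fst_mult)
  then show "fst y = fst w" by simp
  have "degree_is y (l + 0 + - l)" unfolding y_def by (intro degree_mult degree_inv l g w0)
  then show y0: "degree_is y 0" by simp
  assume n: "n \<ge> 1"
  have "lamp k (y \<otimes>\<^bsub>Delta k\<^esub> g) n j = isometry_mult (lamp k y n j) (lamp k g n j)"
    by (rule lamp_mult_base[OF y g y0 n])
  moreover have "lamp k (g \<otimes>\<^bsub>Delta k\<^esub> w) n j = isometry_mult (lamp k g n j) (lamp k w n (j - l))"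
    using lamp_mult_of_degree[OF g w n, of l j] l n by (simp add: degree_is_def)
  ultimately show "isometry_mult (lamp k y n j) (lamp k g n j) = isometry_mult (lamp k g n j) (lamp k w n (j - l))"
    unfolding yg by simp
qed

text \<open>All coordinates of \<open>x\<^sup>2\<close> are translations, and they are trivial at high levels, where those of \<open>x\<close> are
  among \<open>1\<close>, \<open>a\<close> and \<open>b\<close>. In a conjugate each coordinate is a coordinate of \<open>x\<^sup>2\<close> of the same level or its
  inverse.\<close>

lemma finite_conjugates_square:
  assumes x: "x \<in> base"
  shows "finite (conjugates \<Gamma> (x \<otimes>\<^bsub>\<Gamma>\<^esub> x))"
proof -
  define w where "w = x \<otimes>\<^bsub>Delta k\<^esub> x"
  note xD = base_D[OF x]
  have wD: "w \<in> carrier (Delta k)" "degree_is w 0"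
    using xD degree_mult[OF xD(3,3)] by (simp_all add: w_def)
  have lw: "lamp k w n j = isometry_mult (lamp k x n j) (lamp k x n j)" if "n \<ge> 1" for n j
    unfolding w_def by (rule lamp_mult_base[OF xD(2,2,3) that])
  have rot: "fst (lamp k w n j) = False" if "n \<ge> 1" for n j
    using lw[OF that] by (simp add: isometry_mult_def)
  have "tame x" using \<Gamma>_tracked[OF xD(1)] by blast
  then obtain N where N: "\<And>n j. n > N \<Longrightarrow> lamp k x n j \<in> standard"
    unfolding tame_def by blast
  have involution: "isometry_mult u u = (False, 0)" if "u \<in> standard" for u
    using that by (auto simp: standard_def isometry_mult_def)
  have wN: "lamp k w n j = (False, 0)" if "n > N" for n j
    using lw[of n j] involution[OF N[OF that]] that by simp
  define V where "V = (\<lambda>n. if n \<ge> 1 then range (lamp k w n) \<union> (\<lambda>v. (False, - snd v)) ` range (lamp k w n) else {})"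
  have "conjugates \<Gamma> w \<subseteq> {y \<in> carrier (Delta k). fst y = fst w \<and> degree_is y 0 \<and>
      (\<forall>n\<ge>1. \<forall>j. lamp k y n j \<in> V n)}"
  proof
    fix y assume "y \<in> conjugates \<Gamma> w"
    then obtain g where g: "g \<in> carrier \<Gamma>" "y = g \<otimes>\<^bsub>Delta k\<^esub> w \<otimes>\<^bsub>Delta k\<^esub> inv\<^bsub>Delta k\<^esub> g"
      by (auto simp: conjugates_def inv_\<Gamma>)
    obtain l where l: "degree_is g l" using \<Gamma>_tracked[OF g(1)] by blast
    note c = lamp_conjugate[OF \<Gamma>_Delta[OF g(1)] wD(1) l wD(2), folded g(2)]
    have "lamp k y n j \<in> V n" if n: "n \<ge> 1" for n j
    proof -
      define m where "m = snd (lamp k w n (j - l))"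
      have m: "lamp k w n (j - l) = (False, m)" using rot[OF n] by (simp add: m_def prod_eq_iff)
      have "lamp k y n j = (False, m) \<or> lamp k y n j = (False, - m)"
        using c(4)[OF n, of j] unfolding m by (rule isometry_mult_conj_rotation)
      moreover have r: "(False, m) \<in> range (lamp k w n)" unfolding m[symmetric] by (rule rangeI)
      moreover have "(False, - m) \<in> (\<lambda>v. (False, - snd v)) ` range (lamp k w n)"
        using imageI[OF r, of "\<lambda>v. (False, - snd v)"] by simp
      ultimately show ?thesis unfolding V_def if_P[OF n] by (metis UnI1 UnI2)
    qed
    then show "y \<in> {y \<in> carrier (Delta k). fst y = fst w \<and> degree_is y 0 \<and>
      (\<forall>n\<ge>1. \<forall>j. lamp k y n j \<in> V n)}" using c(1-3) by simp
  qed
  moreover have "finite {y \<in> carrier (Delta k). fst y = fst w \<and> degree_is y 0 \<and>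
      (\<forall>n\<ge>1. \<forall>j. lamp k y n j \<in> V n)}"
  proof (rule finite_bounded_lamps[of V N])
    show "finite (V n)" for n by (simp add: V_def finite_range_lamp)
    show "V n \<subseteq> {(False, 0)}" if "n > N" for n
      unfolding V_def using wN[OF that] by (simp add: image_subset_iff)
  qed
  ultimately have "finite (conjugates \<Gamma> w)" by (rule finite_subset)
  then show ?thesis by (simp add: w_def)
qed

theorem almost_central_base: "almost_central_by_rank_one \<Gamma> base"
  unfolding almost_central_by_rank_one_def
proof (intro conjI ballI)
  fix x y assume x: "x \<in> carrier \<Gamma>" and y: "y \<in> carrier \<Gamma>"
  obtain l m where lm: "degree_is x l" "degree_is y m" using \<Gamma>_tracked x y by blast
  \<comment> \<open>the exponents \<open>m\<close> and \<open>- l\<close> cancel the degrees, but both may vanish\<close>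
  define p q where "p = (if m = 0 \<and> l = 0 then 1 else m)" and "q = - l"
  have "degree_is (x [^]\<^bsub>Delta k\<^esub> p \<otimes>\<^bsub>Delta k\<^esub> y [^]\<^bsub>Delta k\<^esub> q) (p * l + q * m)"
    by (intro degree_mult degree_int_pow lm x[THEN \<Gamma>_Delta] y[THEN \<Gamma>_Delta])
  moreover have "p * l + q * m = 0" by (simp add: p_def q_def)
  ultimately have "x [^]\<^bsub>\<Gamma>\<^esub> p \<otimes>\<^bsub>\<Gamma>\<^esub> y [^]\<^bsub>\<Gamma>\<^esub> q \<in> base"
    using x y by (simp add: base_def int_pow_\<Gamma> \<Gamma>_closed)
  moreover have "p \<noteq> 0 \<or> q \<noteq> 0" by (auto simp: p_def q_def)
  ultimately show "\<exists>(p::int) (q::int). (p \<noteq> 0 \<or> q \<noteq> 0) \<and> x [^]\<^bsub>\<Gamma>\<^esub> p \<otimes>\<^bsub>\<Gamma>\<^esub> y [^]\<^bsub>\<Gamma>\<^esub> q \<in> base"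
    by blast
qed (rule subgroup_base | erule (1) commutator_in_base | erule finite_conjugates_square)+

section \<open>Derived length\<close>

definition rotations :: "ambient set" where
  "rotations = {x \<in> base. \<forall>n\<ge>1. \<forall>j. \<not> fst (lamp k x n j)}"

lemma fst_lamp_base:
  assumes "x \<in> base" "n \<ge> 1"
  shows "y \<in> base \<Longrightarrow> fst (lamp k (x \<otimes>\<^bsub>Delta k\<^esub> y) n j) = (fst (lamp k x n j) \<noteq> fst (lamp k y n j))"
    "fst (lamp k (inv\<^bsub>Delta k\<^esub> x) n j) = fst (lamp k x n j)"
proof -
  note x = base_D[OF assms(1)]
  show "fst (lamp k (x \<otimes>\<^bsub>Delta k\<^esub> y) n j) = (fst (lamp k x n j) \<noteq> fst (lamp k y n j))" if "y \<in> base"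
    using lamp_mult_base[OF x(2) base_D(2)[OF that] x(3) assms(2), of j] by (simp add: isometry_mult_def)
  show "fst (lamp k (inv\<^bsub>Delta k\<^esub> x) n j) = fst (lamp k x n j)"
    using lamp_inv_base[OF x(2,3) assms(2), of j] by (simp add: isometry_mult_def)
qed

lemma base_closed:
  "x \<in> base \<Longrightarrow> y \<in> base \<Longrightarrow> x \<otimes>\<^bsub>Delta k\<^esub> y \<in> base"
  "x \<in> base \<Longrightarrow> inv\<^bsub>Delta k\<^esub> x \<in> base"
  "\<one>\<^bsub>Delta k\<^esub> \<in> base"
  using subgroup.m_closed[OF subgroup_base, of x y] subgroup.m_inv_closed[OF subgroup_base, of x]
    subgroup.one_closed[OF subgroup_base] base_D(1)[of x]
  by (simp_all add: inv_\<Gamma>)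

lemma subgroup_rotations: "subgroup rotations \<Gamma>"
proof (rule group.subgroupI[OF group_\<Gamma>])
  show "rotations \<subseteq> carrier \<Gamma>" using base_D(1) by (auto simp: rotations_def)
  have "\<one>\<^bsub>Delta k\<^esub> \<in> rotations" using base_closed(3) k_pos by (simp add: rotations_def)
  then show "rotations \<noteq> {}" by blast
  show "inv\<^bsub>\<Gamma>\<^esub> x \<in> rotations" if "x \<in> rotations" for x
    using that base_closed(2)[of x] fst_lamp_base(2)[of x] base_D(1)[of x] by (simp add: rotations_def inv_\<Gamma>)
  show "x \<otimes>\<^bsub>\<Gamma>\<^esub> y \<in> rotations" if "x \<in> rotations" "y \<in> rotations" for x y
    using that base_closed(1)[of x y] fst_lamp_base(1)[of x _ y] by (simp add: rotations_def)
qed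

lemma rotations_commute:
  assumes "x \<in> rotations" "y \<in> rotations"
  shows "x \<otimes>\<^bsub>Delta k\<^esub> y = y \<otimes>\<^bsub>Delta k\<^esub> x"
proof -
  have b: "x \<in> base" "y \<in> base" using assms by (simp_all add: rotations_def)
  note x = base_D[OF b(1)] and y = base_D[OF b(2)]
  show ?thesis
  proof (rule Delta_eqI)
    fix n :: nat and j :: int assume n: "n \<ge> 1"
    show "shift (x \<otimes>\<^bsub>Delta k\<^esub> y) n = shift (y \<otimes>\<^bsub>Delta k\<^esub> x) n" using n by (simp add: add.commute)
    have "\<not> fst (lamp k x n j)" "\<not> fst (lamp k y n j)" using assms n by (simp_all add: rotations_def)
    then show "lamp k (x \<otimes>\<^bsub>Delta k\<^esub> y) n j = lamp k (y \<otimes>\<^bsub>Delta k\<^esub> x) n j"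
      unfolding lamp_mult_base[OF x(2) y(2) x(3) n] lamp_mult_base[OF y(2) x(2) y(3) n]
      by (simp add: isometry_mult_def)
  qed (use x(2) y(2) in \<open>simp_all add: add.commute\<close>)
qed

lemma derived_carrier_subset_base: "derived \<Gamma> (carrier \<Gamma>) \<subseteq> base"
  unfolding derived_def
proof (rule group.generate_subgroup_incl[OF group_\<Gamma> _ subgroup_base])
  show "derived_set \<Gamma> (carrier \<Gamma>) \<subseteq> base"
    using commutator_in_base by blast
qed

lemma derived_base_subset_rotations: "derived \<Gamma> base \<subseteq> rotations"
  unfolding derived_def
proof (rule group.generate_subgroup_incl[OF group_\<Gamma> _ subgroup_rotations])
  have "x \<otimes>\<^bsub>\<Gamma>\<^esub> y \<otimes>\<^bsub>\<Gamma>\<^esub> inv\<^bsub>\<Gamma>\<^esub> x \<otimes>\<^bsub>\<Gamma>\<^esub> inv\<^bsub>\<Gamma>\<^esub> y \<in> rotations" if x: "x \<in> base" and y: "y \<in> base" for x y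
  proof -
    have "\<not> fst (lamp k (x \<otimes>\<^bsub>Delta k\<^esub> y \<otimes>\<^bsub>Delta k\<^esub> inv\<^bsub>Delta k\<^esub> x \<otimes>\<^bsub>Delta k\<^esub> inv\<^bsub>Delta k\<^esub> y) n j)" if "n \<ge> 1" for n j
      using x y that by (simp add: fst_lamp_base base_closed) blast
    then show ?thesis
      using x y base_D(1)[OF x] base_D(1)[OF y] by (simp add: rotations_def base_closed inv_\<Gamma>)
  qed
  then show "derived_set \<Gamma> base \<subseteq> rotations" by blast
qed

lemma derived_rotations_trivial: "derived \<Gamma> rotations \<subseteq> {\<one>\<^bsub>\<Gamma>\<^esub>}"
  unfolding derived_def
proof (rule group.generate_subgroup_incl[OF group_\<Gamma> _ group.triv_subgroup[OF group_\<Gamma>]])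
  have "x \<otimes>\<^bsub>\<Gamma>\<^esub> y \<otimes>\<^bsub>\<Gamma>\<^esub> inv\<^bsub>\<Gamma>\<^esub> x \<otimes>\<^bsub>\<Gamma>\<^esub> inv\<^bsub>\<Gamma>\<^esub> y = \<one>\<^bsub>\<Gamma>\<^esub>" if x: "x \<in> rotations" and y: "y \<in> rotations" for x y
  proof -
    have c: "x \<in> carrier \<Gamma>" "y \<in> carrier \<Gamma>" using x y base_D(1) by (auto simp: rotations_def)
    note cD = c[THEN \<Gamma>_Delta]
    have "x \<otimes>\<^bsub>Delta k\<^esub> y \<otimes>\<^bsub>Delta k\<^esub> inv\<^bsub>Delta k\<^esub> x \<otimes>\<^bsub>Delta k\<^esub> inv\<^bsub>Delta k\<^esub> y = \<one>\<^bsub>Delta k\<^esub>"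
      unfolding rotations_commute[OF x y] using cD by (simp add: D.m_assoc D.inv_cancel_left)
    then show ?thesis using c by (simp add: inv_\<Gamma>)
  qed
  then show "derived_set \<Gamma> rotations \<subseteq> {\<one>\<^bsub>\<Gamma>\<^esub>}" by blast
qed

lemma third_derived_trivial: "(derived \<Gamma> ^^ 3) (carrier \<Gamma>) = {\<one>\<^bsub>\<Gamma>\<^esub>}"
proof -
  have "derived \<Gamma> (derived \<Gamma> (carrier \<Gamma>)) \<subseteq> rotations"
    using group.mono_derived[OF group_\<Gamma> derived_carrier_subset_base] derived_base_subset_rotations by blast
  then have "derived \<Gamma> (derived \<Gamma> (derived \<Gamma> (carrier \<Gamma>))) \<subseteq> {\<one>\<^bsub>\<Gamma>\<^esub>}"
    using group.mono_derived[OF group_\<Gamma>] derived_rotations_trivial by blast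
  moreover have "\<one>\<^bsub>\<Gamma>\<^esub> \<in> derived \<Gamma> (derived \<Gamma> (derived \<Gamma> (carrier \<Gamma>)))"
    by (simp only: derived_def generate.one)
  ultimately show ?thesis by (simp add: numeral_3_eq_3) blast
qed

text \<open>The elements \<open>u = [s, t]\<close> and \<open>y = t u t\<^sup>-\<^sup>1\<close> of the derived subgroup have \<open>b a\<close> and \<open>a\<close> in position \<open>1\<close> of
  level \<open>1\<close>, so they do not commute.\<close>

lemma second_derived_nontrivial:
  obtains c where "c \<in> derived \<Gamma> (derived \<Gamma> (carrier \<Gamma>))" "c \<noteq> \<one>\<^bsub>\<Gamma>\<^esub>"
proof -
  interpret G: group \<Gamma> by (rule group_\<Gamma>)
  define u where "u = S \<otimes>\<^bsub>\<Gamma>\<^esub> T \<otimes>\<^bsub>\<Gamma>\<^esub> inv\<^bsub>\<Gamma>\<^esub> S \<otimes>\<^bsub>\<Gamma>\<^esub> inv\<^bsub>\<Gamma>\<^esub> T"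
  define y where "y = T \<otimes>\<^bsub>\<Gamma>\<^esub> u \<otimes>\<^bsub>\<Gamma>\<^esub> inv\<^bsub>\<Gamma>\<^esub> T"
  define c where "c = u \<otimes>\<^bsub>\<Gamma>\<^esub> y \<otimes>\<^bsub>\<Gamma>\<^esub> inv\<^bsub>\<Gamma>\<^esub> u \<otimes>\<^bsub>\<Gamma>\<^esub> inv\<^bsub>\<Gamma>\<^esub> y"
  note ST = gens_in_\<Gamma> and STD = gens_in_\<Gamma>[THEN \<Gamma>_Delta]
  have u1: "u \<in> derived \<Gamma> (carrier \<Gamma>)"
    unfolding u_def derived_def by (rule generate.incl) (use ST in blast)
  have y1: "y \<in> derived \<Gamma> (carrier \<Gamma>)"
    using G.derived_is_normal[OF G.normal_self] u1 ST by (simp add: y_def G.normal_inv_iff del: mult_\<Gamma>)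
  have c2: "c \<in> derived \<Gamma> (derived \<Gamma> (carrier \<Gamma>))"
    unfolding c_def derived_def[of _ "derived \<Gamma> (carrier \<Gamma>)"] by (rule generate.incl) (use u1 y1 in blast)
  have ub: "u \<in> base" and yb: "y \<in> base" using u1 y1 derived_carrier_subset_base by blast+
  note uD = base_D[OF ub] and yD = base_D[OF yb]
  have uts: "u \<otimes>\<^bsub>Delta k\<^esub> (T \<otimes>\<^bsub>Delta k\<^esub> S) = S \<otimes>\<^bsub>Delta k\<^esub> T"
    using STD ST by (simp add: u_def inv_\<Gamma> D.m_assoc D.inv_cancel_left)
  have yt: "y \<otimes>\<^bsub>Delta k\<^esub> T = T \<otimes>\<^bsub>Delta k\<^esub> u"
    using STD ST uD by (simp add: y_def inv_\<Gamma> D.m_assoc)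
  have k1: "int (k 1) \<ge> 4" using k_ge[of 1] by simp
  have one: "(1::nat) \<ge> 1" by simp
  have lts: "lamp k (T \<otimes>\<^bsub>Delta k\<^esub> x) 1 j = lamp k x 1 (j - 1)" if "x \<in> carrier (Delta k)" for x j
    using lamp_mult_of_degree[OF STD(2) that one, of 1 j] degree_T lamp_T[OF one, of j] by (simp add: degree_is_def)
  have lst: "lamp k (x \<otimes>\<^bsub>Delta k\<^esub> T) 1 j = lamp k x 1 j" if "x \<in> carrier (Delta k)" "degree_is x 0" for x j
    using lamp_mult_base[OF that(1) STD(2) that(2) one, of j] lamp_T[OF one, of j] by simp
  have lu: "isometry_mult (lamp k u 1 j) (lamp k S 1 (j - 1)) = lamp k S 1 j" for j
    using lamp_mult_base[OF uD(2) _ uD(3) one, of "T \<otimes>\<^bsub>Delta k\<^esub> S" j] STD lst[OF STD(1) degree_S, of j]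
    unfolding uts lts[OF STD(1)] by simp
  have nd: "\<not> int (k 1) dvd -1" "\<not> int (k 1) dvd -2" "\<not> int (k 1) dvd 1"
    using zdvd_imp_le[of "int (k 1)" 1] zdvd_imp_le[of "int (k 1)" 2] k1 by auto
  have S: "lamp k S 1 (-1) = (False, 0)" "lamp k S 1 0 = (True, 0)" "lamp k S 1 1 = (True, 1)"
    using nd by (simp_all add: lamp_S)
  have u0: "lamp k u 1 0 = (True, 0)" using lu[of 0] S by simp
  have "isometry_mult (lamp k u 1 1) (True, 0) = (True, 1)" using lu[of 1] S by simp
  then have u1: "lamp k u 1 1 = (False, 1)"
    by (cases "lamp k u 1 1") (auto simp: isometry_mult_def split: if_splits)
  have "lamp k y 1 1 = lamp k u 1 0"
    using lst[OF yD(2,3), of 1] lts[OF uD(2), of 1] unfolding yt by simp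
  then have y1: "lamp k y 1 1 = (True, 0)" using u0 by simp
  have "lamp k (u \<otimes>\<^bsub>Delta k\<^esub> y) 1 1 \<noteq> lamp k (y \<otimes>\<^bsub>Delta k\<^esub> u) 1 1"
    unfolding lamp_mult_base[OF uD(2) yD(2) uD(3) one] lamp_mult_base[OF yD(2) uD(2) yD(3) one] u1 y1
    by (simp add: isometry_mult_def)
  then have ne: "u \<otimes>\<^bsub>Delta k\<^esub> y \<noteq> y \<otimes>\<^bsub>Delta k\<^esub> u" by metis
  have "c \<otimes>\<^bsub>Delta k\<^esub> (y \<otimes>\<^bsub>Delta k\<^esub> u) = u \<otimes>\<^bsub>Delta k\<^esub> y"
    using uD yD by (simp add: c_def inv_\<Gamma> D.m_assoc D.inv_cancel_left)
  with ne have "c \<noteq> \<one>\<^bsub>Delta k\<^esub>" using uD yD by auto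
  then show ?thesis using that c2 by simp
qed

theorem derived_length_\<Gamma>: "solvable \<Gamma>" "derived_length \<Gamma> = 3"
proof -
  interpret G: group \<Gamma> by (rule group_\<Gamma>)
  show "solvable \<Gamma>"
    using third_derived_trivial unfolding solvable_def
    by (rule G.trivial_derived_seq_imp_solvable[OF G.subgroup_self])
  obtain c where c: "c \<in> derived \<Gamma> (derived \<Gamma> (carrier \<Gamma>))" "c \<noteq> \<one>\<^bsub>\<Gamma>\<^esub>"
    by (rule second_derived_nontrivial)
  have s1: "derived \<Gamma> (carrier \<Gamma>) \<subseteq> carrier \<Gamma>" by (rule G.derived_in_carrier) simp
  have s2: "derived \<Gamma> (derived \<Gamma> (carrier \<Gamma>)) \<subseteq> derived \<Gamma> (carrier \<Gamma>)"
    by (rule G.mono_derived[OF s1])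
  show "derived_length \<Gamma> = 3"
    unfolding derived_length_def
  proof (rule Least_equality)
    show "(derived \<Gamma> ^^ 3) (carrier \<Gamma>) = {\<one>\<^bsub>\<Gamma>\<^esub>}" by (rule third_derived_trivial)
    fix n assume n: "(derived \<Gamma> ^^ n) (carrier \<Gamma>) = {\<one>\<^bsub>\<Gamma>\<^esub>}"
    show "3 \<le> n"
    proof (rule ccontr)
      assume "\<not> 3 \<le> n"
      then have "n = 0 \<or> n = 1 \<or> n = 2" by auto
      then have "c \<in> (derived \<Gamma> ^^ n) (carrier \<Gamma>)"
        using c(1) s1 s2 by (auto simp: numeral_2_eq_2)
      then show False using n c(2) by simp
    qed
  qed
qed

section \<open>A free abelian normal subgroup\<close>

text \<open>The commutator subgroup of the infinite dihedral group is generated by \<open>(b a)\<^sup>2\<close>, hence the factor \<open>2\<close>. The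
  second argument of \<open>p\<close> runs over the coordinates \<open>1, \<dots>, k n\<close>.\<close>

definition lattice_elem :: "(nat \<Rightarrow> int \<Rightarrow> int) \<Rightarrow> ambient" where
  "lattice_elem p = (0, \<lambda>n\<in>{1..}. (\<lambda>i\<in>{1..int (k n)}. dihedral_of (False, 2 * p n i), 0))"

lemma lattice_elem_Delta: "lattice_elem p \<in> carrier (Delta k)"
  unfolding mem_Delta_iff by (auto simp: lattice_elem_def dihedral_of_in_Dinf integer_mod_group_0)

lemma fst_lattice_elem [simp]: "fst (lattice_elem p) = 0"
  by (simp add: lattice_elem_def)

lemma shift_lattice_elem: "n \<ge> 1 \<Longrightarrow> shift (lattice_elem p) n = 0"
  by (simp add: lattice_elem_def)

lemma degree_lattice_elem: "degree_is (lattice_elem p) 0"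
  by (simp add: degree_zero_iff shift_lattice_elem)

lemma lamp_lattice_elem: "n \<ge> 1 \<Longrightarrow> lamp k (lattice_elem p) n j = (False, 2 * p n (j mod int (k n) + 1))"
  using mod_range[OF k_pos, of n j] by (simp add: lamp_def lattice_elem_def)

lemma lattice_elem_eq_iff:
  "lattice_elem p = lattice_elem q \<longleftrightarrow> (\<forall>n\<ge>1. \<forall>i\<in>{1..int (k n)}. p n i = q n i)"
proof (intro iffI allI ballI impI)
  fix n :: nat and i assume eq: "lattice_elem p = lattice_elem q" and n: "n \<ge> 1" and i: "i \<in> {1..int (k n)}"
  have "(i - 1) mod int (k n) + 1 = i" using i by simp
  then show "p n i = q n i"
    using lamp_lattice_elem[OF n, of p "i - 1"] lamp_lattice_elem[OF n, of q "i - 1"] eq by simp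
next
  assume eq: "\<forall>n\<ge>1. \<forall>i\<in>{1..int (k n)}. p n i = q n i"
  show "lattice_elem p = lattice_elem q"
  proof (rule Delta_eqI[OF lattice_elem_Delta lattice_elem_Delta])
    fix n :: nat and j assume n: "n \<ge> 1"
    have "j mod int (k n) + 1 \<in> {1..int (k n)}" using mod_range[OF k_pos[OF n], of j] by simp
    then show "lamp k (lattice_elem p) n j = lamp k (lattice_elem q) n j"
      using eq n by (simp add: lamp_lattice_elem)
  qed (simp_all add: shift_lattice_elem)
qed

lemma lattice_elem_add:
  "lattice_elem p \<otimes>\<^bsub>Delta k\<^esub> lattice_elem q = lattice_elem (\<lambda>n i. p n i + q n i)"
proof (rule Delta_eqI)
  fix n :: nat and j assume n: "n \<ge> 1"
  show "lamp k (lattice_elem p \<otimes>\<^bsub>Delta k\<^esub> lattice_elem q) n j = lamp k (lattice_elem (\<lambda>n i. p n i + q n i)) n j"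
    unfolding lamp_mult_base[OF lattice_elem_Delta lattice_elem_Delta degree_lattice_elem n] lamp_lattice_elem[OF n]
    by (simp add: isometry_mult_def)
qed (simp_all add: lattice_elem_Delta shift_lattice_elem)

lemma lattice_elem_zero: "lattice_elem (\<lambda>_ _. 0) = \<one>\<^bsub>Delta k\<^esub>"
  by (rule Delta_eqI[OF lattice_elem_Delta D.one_closed]) (simp_all add: shift_lattice_elem lamp_lattice_elem k_pos)

lemma lattice_elem_minus: "lattice_elem (\<lambda>n i. - p n i) = inv\<^bsub>Delta k\<^esub> lattice_elem p"
  by (rule D.inv_equality[symmetric]) (simp_all add: lattice_elem_Delta lattice_elem_add lattice_elem_zero)

lemma lattice_elem_scale: "lattice_elem (\<lambda>n i. c * p n i) = lattice_elem p [^]\<^bsub>Delta k\<^esub> c"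
proof -
  have nat: "lattice_elem p [^]\<^bsub>Delta k\<^esub> m = lattice_elem (\<lambda>n i. int m * p n i)" for m :: nat
  proof (induction m)
    case (Suc m)
    have "lattice_elem p [^]\<^bsub>Delta k\<^esub> Suc m = lattice_elem (\<lambda>n i. int m * p n i) \<otimes>\<^bsub>Delta k\<^esub> lattice_elem p"
      by (simp add: Suc)
    then show ?case unfolding lattice_elem_add by (simp add: algebra_simps)
  qed (simp add: lattice_elem_zero)
  show ?thesis
  proof (cases c rule: int_cases2)
    case (nonneg m)
    then show ?thesis by (simp add: int_pow_int nat)
  next
    case (nonpos m)
    then show ?thesis by (simp add: D.int_pow_neg_int lattice_elem_Delta nat lattice_elem_minus[symmetric])
  qed
qed

lemma eq_lattice_elem:
  assumes x: "x \<in> carrier (Delta k)" "fst x = 0" "degree_is x 0"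
    and la: "\<And>n j. n \<ge> 1 \<Longrightarrow> \<exists>m. lamp k x n j = (False, 2 * m)"
  shows "x = lattice_elem (\<lambda>n i. if n \<ge> 1 then snd (lamp k x n (i - 1)) div 2 else 0)"
proof (rule Delta_eqI[OF x(1) lattice_elem_Delta])
  fix n :: nat and j assume n: "n \<ge> 1"
  show "shift x n = shift (lattice_elem (\<lambda>n i. if n \<ge> 1 then snd (lamp k x n (i - 1)) div 2 else 0)) n"
    using x(3) n by (simp add: degree_is_def shift_lattice_elem)
  obtain m where m: "lamp k x n (j mod int (k n)) = (False, 2 * m)" using la[OF n] by blast
  have "lamp k x n j = lamp k x n (j mod int (k n))" by (rule lamp_cong) simp
  then show "lamp k x n j = lamp k (lattice_elem (\<lambda>n i. if n \<ge> 1 then snd (lamp k x n (i - 1)) div 2 else 0)) n j"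
    using n m by (simp add: lamp_lattice_elem)
qed (use x in simp)

definition translate :: "nat \<Rightarrow> ambient" where
  "translate l = T [^]\<^bsub>Delta k\<^esub> l \<otimes>\<^bsub>Delta k\<^esub> S \<otimes>\<^bsub>Delta k\<^esub> inv\<^bsub>Delta k\<^esub> (T [^]\<^bsub>Delta k\<^esub> l)"

lemma translate_base: "translate l \<in> base"
  and lamp_translate: "n \<ge> 1 \<Longrightarrow> lamp k (translate l) n j = lamp k S n (j - int l)"
proof -
  have T: "degree_is (T [^]\<^bsub>Delta k\<^esub> l) (int l)" "T [^]\<^bsub>Delta k\<^esub> l \<in> carrier (Delta k)"
    using degree_nat_pow[OF gens_in_Delta(2) degree_T, of l] gens_in_Delta by simp_all
  note c = lamp_conjugate[OF T(2) gens_in_Delta(1) T(1) degree_S, folded translate_def]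
  have "translate l \<in> carrier \<Gamma>" unfolding translate_def by (intro \<Gamma>_closed gens_in_\<Gamma>)
  then show "translate l \<in> base" using c(3) by (simp add: base_def)
  assume n: "n \<ge> 1"
  have "lamp k (T [^]\<^bsub>Delta k\<^esub> m) n j = (False, 0)" for m :: nat
  proof (induction m)
    case (Suc m)
    have "T [^]\<^bsub>Delta k\<^esub> m \<in> carrier (Delta k)" using gens_in_Delta by simp
    from lamp_mult[OF this gens_in_Delta(2) n k_pos[OF n], of j] Suc show ?case
      by (simp add: lamp_T[OF n])
  qed (use n k_pos[OF n] in simp)
  then show "lamp k (translate l) n j = lamp k S n (j - int l)" using c(4)[OF n, of j] by simp
qed

lemma lamp_S_standard: "n \<ge> 1 \<Longrightarrow> lamp k S n j \<in> standard"
  by (simp add: lamp_S standard_def)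

lemma not_dvd_between: "0 < z \<Longrightarrow> z < int (k n) \<Longrightarrow> \<not> int (k n) dvd z"
  using zdvd_imp_le[of "int (k n)" z] by linarith

text \<open>At level \<open>n\<close> the commutator of \<open>s\<^sub>a\<close> and \<open>s\<^sub>a\<^sub>+\<^sub>n\<close> is concentrated in position \<open>a + n\<close>, where the \<open>b\<close> of the
  first element meets the \<open>a\<close> of the second. At a level \<open>m > n\<close> no such letters meet, because \<open>k m\<close> divides
  neither \<open>m - n\<close> nor \<open>m + n\<close>. Coordinates of lower levels may occur as well, but only as powers of \<open>(b a)\<^sup>2\<close>.\<close>

lemma commutator_of_translates:
  assumes n: "n \<ge> 1" and i0: "i0 \<in> {1..int (k n)}"
  shows "\<exists>p. lattice_elem p \<in> carrier \<Gamma> \<and> (\<forall>m>n. \<forall>i. p m i = 0) \<and>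
           (\<forall>i\<in>{1..int (k n)}. p n i = (if i = i0 then 1 else 0))"
proof -
  \<comment> \<open>position \<open>a + n\<close> is congruent to \<open>i0 - 1\<close>, that is to coordinate \<open>i0\<close> counted from \<open>1\<close>\<close>
  define a where "a = nat ((i0 - 1 - int n) mod int (k n))"
  have a: "int a = (i0 - 1 - int n) mod int (k n)"
    using k_pos[OF n] by (simp add: a_def)
  define x where "x = translate a"
  define y where "y = translate (a + n)"
  define u where "u = x \<otimes>\<^bsub>Delta k\<^esub> y \<otimes>\<^bsub>Delta k\<^esub> inv\<^bsub>Delta k\<^esub> x \<otimes>\<^bsub>Delta k\<^esub> inv\<^bsub>Delta k\<^esub> y"
  have b: "x \<in> base" "y \<in> base" by (simp_all add: x_def y_def translate_base)
  then have ub: "u \<in> base" by (simp add: u_def base_closed)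
  note xD = base_D[OF b(1)] and yD = base_D[OF b(2)] and uD = base_D[OF ub]
  have u: "u \<otimes>\<^bsub>Delta k\<^esub> (y \<otimes>\<^bsub>Delta k\<^esub> x) = x \<otimes>\<^bsub>Delta k\<^esub> y"
    using xD yD by (simp add: u_def D.m_assoc D.inv_cancel_left)
  then have "fst u + (fst y + fst x) = fst x + fst y" by (metis fst_mult)
  then have fu: "fst u = 0" by simp
  define e where "e = (\<lambda>m j. if lamp k x m j = (True, 1) \<and> lamp k y m j = (True, 0) then 1
                          else if lamp k x m j = (True, 0) \<and> lamp k y m j = (True, 1) then -1 else 0 :: int)"
  have lu: "lamp k u m j = (False, 2 * e m j)" if m: "m \<ge> 1" for m j
  proof -
    have yx: "y \<otimes>\<^bsub>Delta k\<^esub> x \<in> carrier (Delta k)" using xD yD by simp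
    have "isometry_mult (lamp k u m j) (isometry_mult (lamp k y m j) (lamp k x m j)) = isometry_mult (lamp k x m j) (lamp k y m j)"
      using lamp_mult_base[OF uD(2) yx uD(3) m, of j] unfolding u
        lamp_mult_base[OF xD(2) yD(2) xD(3) m] lamp_mult_base[OF yD(2) xD(2) yD(3) m] by simp
    then show ?thesis unfolding e_def
      by (rule standard_commutator) (simp_all only: x_def y_def lamp_translate[OF m] lamp_S_standard[OF m])
  qed
  have lx: "lamp k x m j = lamp k S m (j - int a)" and ly: "lamp k y m j = lamp k S m (j - int a - int n)"
    if "m \<ge> 1" for m j
    using that by (simp_all add: x_def y_def lamp_translate algebra_simps)
  have high: "e m j = 0" if m: "m > n" for m j
  proof -
    have m1: "m \<ge> 1" using m by simp
    have km: "2 * int m < int (k m)" using k_ge[OF m1] by simp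
    have "\<not> int (k m) dvd int m - int n" "\<not> int (k m) dvd int m + int n"
      by (rule not_dvd_between; use m km n in linarith)+
    moreover have "int m - int n = (r - int n) - (r - int m)" "int m + int n = r - (r - int n - int m)" for r
      by simp_all
    ultimately have "\<not> (int (k m) dvd r - int n \<and> int (k m) dvd r - int m)"
      "\<not> (int (k m) dvd r \<and> int (k m) dvd r - int n - int m)" for r
      using dvd_diff by metis+
    then show ?thesis unfolding e_def lx[OF m1] ly[OF m1] lamp_S[OF m1] by (auto split: if_splits)
  qed
  have top: "e n j = (if int (k n) dvd j - int a - int n then 1 else 0)" for j
  proof -
    have kn: "2 * int n < int (k n)" using k_ge[OF n] by simp
    have "\<not> int (k n) dvd int n" "\<not> int (k n) dvd int n + int n"
      by (rule not_dvd_between; use kn n in linarith)+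
    moreover have "int n = r - (r - int n)" "int n + int n = r - (r - int n - int n)" for r by simp_all
    ultimately have "\<not> (int (k n) dvd r \<and> int (k n) dvd r - int n)"
      "\<not> (int (k n) dvd r \<and> int (k n) dvd r - int n - int n)" for r
      using dvd_diff by metis+
    then show ?thesis unfolding e_def lx[OF n] ly[OF n] lamp_S[OF n] by (auto split: if_splits)
  qed
  define p where "p = (\<lambda>m i. if m \<ge> 1 then snd (lamp k u m (i - 1)) div 2 else 0)"
  have "u = lattice_elem p"
    unfolding p_def by (rule eq_lattice_elem[OF uD(2) fu uD(3)]) (use lu in blast)
  moreover have "p m i = 0" if "m > n" for m i using high[OF that] lu[of m] that by (simp add: p_def)
  moreover have "p n i = (if i = i0 then 1 else 0)" if i: "i \<in> {1..int (k n)}" for i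
  proof -
    have "int (k n) dvd i - 1 - int a - int n \<longleftrightarrow> (i - 1 - int n) mod int (k n) = int a mod int (k n)"
      by (simp add: mod_eq_dvd_iff algebra_simps)
    also have "\<dots> \<longleftrightarrow> (i - 1 - int n) mod int (k n) = (i0 - 1 - int n) mod int (k n)"
      by (simp add: a)
    also have "\<dots> \<longleftrightarrow> int (k n) dvd i - i0" by (simp add: mod_eq_dvd_iff algebra_simps)
    also have "\<dots> \<longleftrightarrow> i = i0"
    proof
      assume dv: "int (k n) dvd i - i0"
      show "i = i0"
      proof (rule ccontr)
        assume "i \<noteq> i0"
        then have "int (k n) \<le> \<bar>i - i0\<bar>" using dvd_imp_le_int[OF _ dv] by simp
        then show False using i i0 by auto
      qed
    qed simp
    finally show ?thesis using lu[OF n, of "i - 1"] top[of "i - 1"] n by (simp add: p_def)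
  qed
  ultimately show ?thesis using uD(1) by metis
qed

text \<open>The commutators of translates form a triangular system with respect to the level. Multiples of them
  clear the coordinates of the top level one by one, and induction takes care of the lower levels.\<close>

lemma lattice_elem_in_\<Gamma>:
  "(\<And>n i. n > N \<Longrightarrow> p n i = 0) \<Longrightarrow> lattice_elem p \<in> carrier \<Gamma>"
proof (induction N arbitrary: p)
  case 0
  then have "lattice_elem p = lattice_elem (\<lambda>_ _. 0)" by (simp add: lattice_elem_eq_iff)
  then show ?case by (simp add: lattice_elem_zero \<Gamma>_closed)
next
  case (Suc N)
  define n where "n = Suc N"
  have n: "n \<ge> 1" by (simp add: n_def)
  have "lattice_elem p \<in> carrier \<Gamma>"
    if "finite J" "\<And>m i. m > n \<Longrightarrow> p m i = 0" "\<And>i. i \<in> {1..int (k n)} - J \<Longrightarrow> p n i = 0" for J p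
    using that
  proof (induction J arbitrary: p rule: finite_induct)
    case empty
    define p' where "p' = (\<lambda>m i. if m = n then 0 else p m i)"
    have "lattice_elem p = lattice_elem p'"
      using empty(2) by (simp add: lattice_elem_eq_iff p'_def)
    moreover have "lattice_elem p' \<in> carrier \<Gamma>"
    proof (rule Suc.IH)
      fix m i assume "N < m"
      then have "m = n \<or> m > n" by (auto simp: n_def)
      then show "p' m i = 0" using empty(1) by (auto simp: p'_def)
    qed
    ultimately show ?case by simp
  next
    case (insert i0 J)
    show ?case
    proof (cases "i0 \<in> {1..int (k n)}")
      case True
      obtain q where q: "lattice_elem q \<in> carrier \<Gamma>" "\<And>m i. m > n \<Longrightarrow> q m i = 0"
        "\<And>i. i \<in> {1..int (k n)} \<Longrightarrow> q n i = (if i = i0 then 1 else 0)"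
        using commutator_of_translates[OF n True] by blast
      define c where "c = p n i0"
      have "lattice_elem (\<lambda>m i. p m i - c * q m i) \<in> carrier \<Gamma>"
      proof (rule insert.IH)
        show "p m i - c * q m i = 0" if "m > n" for m i using insert.prems(1) q(2) that by simp
        show "p n i - c * q n i = 0" if "i \<in> {1..int (k n)} - J" for i
          using insert.prems(2)[of i] q(3)[of i] that by (cases "i = i0") (auto simp: c_def)
      qed
      moreover have "lattice_elem (\<lambda>m i. c * q m i) \<in> carrier \<Gamma>"
        unfolding lattice_elem_scale using q(1) by (rule \<Gamma>_closed)
      ultimately have "lattice_elem (\<lambda>m i. p m i - c * q m i) \<otimes>\<^bsub>Delta k\<^esub> lattice_elem (\<lambda>m i. c * q m i) \<in> carrier \<Gamma>"
        by (rule \<Gamma>_closed)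
      then show ?thesis by (simp add: lattice_elem_add)
    next
      case False
      show ?thesis by (rule insert.IH) (use insert.prems False in auto)
    qed
  qed
  from this[of "{1..int (k n)}" p] Suc.prems show ?case by (simp add: n_def)
qed

text \<open>For positive \<open>n\<close> there are only finitely many coordinates, so restricting the levels makes the support
  finite.\<close>

definition lattice :: "ambient set" where
  "lattice = {lattice_elem p | p. \<exists>N. \<forall>n>N. \<forall>i. p n i = 0}"

lemma latticeI: "(\<And>n i. n > N \<Longrightarrow> p n i = 0) \<Longrightarrow> lattice_elem p \<in> lattice"
  unfolding lattice_def by blast

lemma latticeE:
  assumes "x \<in> lattice"
  obtains p N where "x = lattice_elem p" "\<And>n i. n > N \<Longrightarrow> p n i = 0"
  using assms unfolding lattice_def by blast

lemma lattice_subset: "lattice \<subseteq> carrier \<Gamma>"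
  unfolding lattice_def using lattice_elem_in_\<Gamma> by blast

lemma lattice_normal: "lattice \<lhd> \<Gamma>"
proof -
  interpret G: group \<Gamma> by (rule group_\<Gamma>)
  have sub: "subgroup lattice \<Gamma>"
  proof (rule G.subgroupI[OF lattice_subset])
    have "lattice_elem (\<lambda>_ _. 0) \<in> lattice" by (rule latticeI) simp
    then show "lattice \<noteq> {}" by blast
  next
    fix x assume x: "x \<in> lattice"
    then obtain p N where p: "x = lattice_elem p" "\<And>n i. n > N \<Longrightarrow> p n i = 0" by (rule latticeE) blast
    have "lattice_elem (\<lambda>n i. - p n i) \<in> lattice" by (rule latticeI[of N]) (simp add: p)
    moreover have "x \<in> carrier \<Gamma>" using x lattice_subset by blast
    ultimately show "inv\<^bsub>\<Gamma>\<^esub> x \<in> lattice" by (simp add: inv_\<Gamma> p(1) lattice_elem_minus)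
  next
    fix x y assume x: "x \<in> lattice" and y: "y \<in> lattice"
    obtain p N where p: "x = lattice_elem p" "\<And>n i. n > N \<Longrightarrow> p n i = 0" using x by (rule latticeE) blast
    obtain q M where q: "y = lattice_elem q" "\<And>n i. n > M \<Longrightarrow> q n i = 0" using y by (rule latticeE) blast
    have "lattice_elem (\<lambda>n i. p n i + q n i) \<in> lattice" by (rule latticeI[of "N + M"]) (simp add: p q)
    then show "x \<otimes>\<^bsub>\<Gamma>\<^esub> y \<in> lattice" by (simp add: p(1) q(1) lattice_elem_add)
  qed
  have conj: "g \<otimes>\<^bsub>\<Gamma>\<^esub> x \<otimes>\<^bsub>\<Gamma>\<^esub> inv\<^bsub>\<Gamma>\<^esub> g \<in> lattice" if g: "g \<in> carrier \<Gamma>" and x: "x \<in> lattice" for g x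
  proof -
    obtain p N where p: "x = lattice_elem p" "\<And>n i. n > N \<Longrightarrow> p n i = 0" using x by (rule latticeE) blast
    obtain l where l: "degree_is g l" using \<Gamma>_tracked[OF g] by blast
    define y where "y = g \<otimes>\<^bsub>Delta k\<^esub> x \<otimes>\<^bsub>Delta k\<^esub> inv\<^bsub>Delta k\<^esub> g"
    note c = lamp_conjugate[OF \<Gamma>_Delta[OF g] lattice_elem_Delta[of p] l degree_lattice_elem, folded p(1), folded y_def]
    have la: "lamp k y n j = (False, 2 * p n ((j - l) mod int (k n) + 1)) \<or>
        lamp k y n j = (False, - (2 * p n ((j - l) mod int (k n) + 1)))" if n: "n \<ge> 1" for n j
      using c(4)[OF n, of j] unfolding p(1) lamp_lattice_elem[OF n] by (rule isometry_mult_conj_rotation)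
    have ex: "\<exists>m. lamp k y n j = (False, 2 * m)" if n: "n \<ge> 1" for n j
      using la[OF n, of j] by (metis mult_minus_right)
    have "fst y = 0" using c(2) by (simp add: p(1))
    note eq = eq_lattice_elem[OF c(1) this c(3) ex]
    have "lattice_elem (\<lambda>n i. if n \<ge> 1 then snd (lamp k y n (i - 1)) div 2 else 0) \<in> lattice"
    proof (rule latticeI[of N])
      fix n i assume "N < n"
      then have "lamp k y n (i - 1) = (False, 0)" using la[of n "i - 1"] p(2)[of n] by simp
      then show "(if n \<ge> 1 then snd (lamp k y n (i - 1)) div 2 else 0) = 0" by simp
    qed
    then have "y \<in> lattice" using eq by simp
    then show ?thesis using g by (simp add: y_def inv_\<Gamma>)
  qed
  show ?thesis unfolding G.normal_inv_iff using sub conj by blast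
qed

definition lattice_index :: "(nat \<times> int) set" where
  "lattice_index = {(n, i). n \<ge> 1 \<and> i \<in> {1..int (k n)}}"

definition lattice_basis :: "nat \<times> int \<Rightarrow> ambient" where
  "lattice_basis v = lattice_elem (\<lambda>m j. if (m, j) = v then 1 else 0)"

lemma inj_lattice_basis: "inj_on lattice_basis lattice_index"
proof (rule inj_onI)
  fix v w assume v: "v \<in> lattice_index" and eq: "lattice_basis v = lattice_basis w"
  have "fst v \<ge> 1" "snd v \<in> {1..int (k (fst v))}" using v by (auto simp: lattice_index_def)
  then have "(if (fst v, snd v) = v then 1 else 0 :: int) = (if (fst v, snd v) = w then 1 else 0)"
    using eq unfolding lattice_basis_def lattice_elem_eq_iff by blast
  then show "v = w" by (simp split: if_splits)
qed

lemma infinite_lattice_basis: "infinite (lattice_basis ` lattice_index)"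
proof -
  have "range (\<lambda>n. (Suc n, 1)) \<subseteq> lattice_index"
  proof (rule image_subsetI)
    fix n show "(Suc n, 1) \<in> lattice_index" using k_pos[of "Suc n"] by (simp add: lattice_index_def)
  qed
  moreover have "infinite (range (\<lambda>n. (Suc n, 1 :: int)))"
    by (rule range_inj_infinite) (simp add: inj_def)
  ultimately have "infinite lattice_index" by (rule infinite_super)
  then show ?thesis using finite_imageD[OF _ inj_lattice_basis] by blast
qed

text \<open>The isomorphism maps a formal combination of basis elements to the element of the lattice with the
  same coefficients.\<close>

theorem free_lattice: "free_abelian_of_infinite_rank (\<Gamma>\<lparr>carrier := lattice\<rparr>)"
proof -
  define Y where "Y = lattice_basis ` lattice_index"
  \<comment> \<open>the default value \<open>0\<close> outside the index set keeps \<open>p f\<close> supported on finitely many levels\<close>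
  define p where "p = (\<lambda>(f :: ambient \<Rightarrow>\<^sub>0 int) n i.
    if (n, i) \<in> lattice_index then Poly_Mapping.lookup f (lattice_basis (n, i)) else 0)"
  define \<Phi> where "\<Phi> = (\<lambda>f. lattice_elem (p f))"
  have carrier_F: "carrier (free_Abelian_group Y) = {f. Poly_Mapping.keys f \<subseteq> Y}"
    and mult_F: "monoid.mult (free_Abelian_group Y) = (+)"
    by (simp_all add: free_Abelian_group_def)
  have in_lattice: "\<Phi> f \<in> lattice" for f
  proof -
    define W where "W = {v \<in> lattice_index. lattice_basis v \<in> Poly_Mapping.keys f}"
    have "lattice_basis ` W \<subseteq> Poly_Mapping.keys f" by (auto simp: W_def)
    then have "finite (lattice_basis ` W)" using finite_keys finite_subset by blast
    moreover have "inj_on lattice_basis W"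
      using inj_lattice_basis by (rule inj_on_subset) (auto simp: W_def)
    ultimately have fin: "finite W" by (rule finite_imageD)
    show ?thesis unfolding \<Phi>_def
    proof (rule latticeI[of "Max (insert 0 (fst ` W))"])
      fix n i assume n: "Max (insert 0 (fst ` W)) < n"
      have "(n, i) \<notin> W"
      proof
        assume "(n, i) \<in> W"
        then have "n \<in> insert 0 (fst ` W)" by force
        then have "n \<le> Max (insert 0 (fst ` W))" using fin by (intro Max_ge) auto
        with n show False by simp
      qed
      then show "p f n i = 0" by (auto simp: p_def W_def in_keys_iff)
    qed
  qed
  have hom: "\<Phi> \<in> hom (free_Abelian_group Y) (\<Gamma>\<lparr>carrier := lattice\<rparr>)"
  proof (rule homI)
    fix f g
    have "p (f + g) = (\<lambda>n i. p f n i + p g n i)" by (auto simp: p_def lookup_add fun_eq_iff)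
    then show "\<Phi> (f \<otimes>\<^bsub>free_Abelian_group Y\<^esub> g) = \<Phi> f \<otimes>\<^bsub>\<Gamma>\<lparr>carrier := lattice\<rparr>\<^esub> \<Phi> g"
      by (simp add: mult_F \<Phi>_def lattice_elem_add)
  qed (simp add: in_lattice)
  have inj: "inj_on \<Phi> (carrier (free_Abelian_group Y))"
  proof (rule inj_onI)
    fix f g assume f: "f \<in> carrier (free_Abelian_group Y)" and g: "g \<in> carrier (free_Abelian_group Y)"
      and eq: "\<Phi> f = \<Phi> g"
    show "f = g"
    proof (rule poly_mapping_eqI)
      fix v
      show "Poly_Mapping.lookup f v = Poly_Mapping.lookup g v"
      proof (cases "v \<in> Y")
        case True
        then obtain n i where v: "v = lattice_basis (n, i)" "(n, i) \<in> lattice_index" by (auto simp: Y_def)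
        then have "p f n i = p g n i"
          using eq by (simp add: \<Phi>_def lattice_elem_eq_iff lattice_index_def)
        then show ?thesis using v by (simp add: p_def)
      next
        case False
        then have "v \<notin> Poly_Mapping.keys f" "v \<notin> Poly_Mapping.keys g" using f g by (auto simp: carrier_F)
        then show ?thesis by (simp add: in_keys_iff)
      qed
    qed
  qed
  have surj: "lattice \<subseteq> \<Phi> ` carrier (free_Abelian_group Y)"
  proof
    fix x assume "x \<in> lattice"
    then obtain q N where q: "x = lattice_elem q" "\<And>n i. n > N \<Longrightarrow> q n i = 0" by (rule latticeE) blast
    define g where "g = (\<lambda>v. if v \<in> Y then case_prod q (inv_into lattice_index lattice_basis v) else 0)"
    have gb: "g (lattice_basis (n, i)) = q n i" if "(n, i) \<in> lattice_index" for n i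
      using that by (simp add: g_def Y_def inv_into_f_f[OF inj_lattice_basis])
    have "{v. g v \<noteq> 0} \<subseteq> lattice_basis ` (SIGMA n:{1..N}. {1..int (k n)})"
    proof
      fix v assume "v \<in> {v. g v \<noteq> 0}"
      then have gv: "g v \<noteq> 0" by simp
      then have "v \<in> Y" by (simp add: g_def split: if_splits)
      then obtain n i where v: "v = lattice_basis (n, i)" "(n, i) \<in> lattice_index" by (auto simp: Y_def)
      then have "q n i \<noteq> 0" using gv gb by simp
      then have "n \<le> N" using q(2)[of n i] by (meson not_le)
      then show "v \<in> lattice_basis ` (SIGMA n:{1..N}. {1..int (k n)})"
        using v by (auto simp: lattice_index_def)
    qed
    then have fin: "finite {v. g v \<noteq> 0}" by (rule finite_subset) simp
    define f where "f = Abs_poly_mapping g"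
    have f: "Poly_Mapping.lookup f = g" using fin by (simp add: f_def)
    have "Poly_Mapping.keys f \<subseteq> Y" by (auto simp: in_keys_iff f g_def split: if_splits)
    moreover have "x = \<Phi> f"
      unfolding q(1) \<Phi>_def lattice_elem_eq_iff by (auto simp: p_def f gb lattice_index_def)
    ultimately show "x \<in> \<Phi> ` carrier (free_Abelian_group Y)" by (auto simp: carrier_F)
  qed
  have "\<Phi> ` carrier (free_Abelian_group Y) = lattice" using in_lattice surj by blast
  then have "\<Phi> \<in> iso (free_Abelian_group Y) (\<Gamma>\<lparr>carrier := lattice\<rparr>)"
    using hom inj by (simp add: iso_def bij_betw_def)
  then have "free_Abelian_group Y \<cong> \<Gamma>\<lparr>carrier := lattice\<rparr>" by (auto simp: is_iso_def)
  then have "\<Gamma>\<lparr>carrier := lattice\<rparr> \<cong> free_Abelian_group Y"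
    by (rule group.iso_sym[OF group_free_Abelian_group])
  then show ?thesis
    unfolding free_abelian_of_infinite_rank_def using infinite_lattice_basis by (auto simp: Y_def)
qed

end

section \<open>The properties of the generated group\<close>

lemma odd_of_generates_integers:
  assumes "generate integer_group {\<sigma>} = carrier integer_group"
  shows "odd \<sigma>"
proof (rule ccontr)
  assume "\<not> odd \<sigma>"
  have "even x" if "x \<in> generate integer_group {\<sigma>}" for x
    using that
  proof induction
    case (inv h)
    then show ?case using \<open>\<not> odd \<sigma>\<close> by simp
  qed (use \<open>\<not> odd \<sigma>\<close> in auto)
  from this[of 1] show False using assms by simp
qed

theorem theorem1p1:
  fixes d k :: "nat \<Rightarrow> nat" and \<sigma>\<^sub>0 :: int and G :: "ambient monoid"
  assumes d: "\<And>n. n \<ge> 1 \<Longrightarrow> d n = n + 1"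
    and k_mono: "strict_mono_on {1..} k"
    and k_pos: "\<And>n. n \<ge> 1 \<Longrightarrow> k n > 0"
    and k_ge: "\<And>n. n \<ge> 1 \<Longrightarrow> k n \<ge> 2 * d n"
    and \<sigma>\<^sub>0: "generate integer_group {\<sigma>\<^sub>0} = carrier integer_group"
    and G: "G = G_group \<sigma>\<^sub>0 d k"
  shows "group G \<and> finitely_generated G \<and> solvable G \<and> derived_length G = 3
    \<and> torsion_free G
    \<and> (\<exists>N. N \<lhd> G \<and> free_abelian_of_infinite_rank (G\<lparr>carrier := N\<rparr>))
    \<and> (\<forall>Q :: 'q monoid. subquotient Q G \<and> finitely_generated Q \<and> torsion_free Q \<and> metabelian Q
          \<longrightarrow> virtually_abelian Q)"
proof -
  interpret dihedral_lamps k d \<sigma>\<^sub>0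
  proof
    show "odd \<sigma>\<^sub>0" by (rule odd_of_generates_integers[OF \<sigma>\<^sub>0])
    show "d n = n + 1" if "n \<ge> 1" for n using that by (rule d)
    show "2 * (n + 1) \<le> k n" if "n \<ge> 1" for n using k_ge[OF that] d[OF that] by simp
  qed
  show ?thesis
    unfolding G
    using group_\<Gamma> finitely_generated_\<Gamma> derived_length_\<Gamma> torsion_free_\<Gamma> lattice_normal free_lattice
      virtually_abelian_subquotient[OF group_\<Gamma> almost_central_base]
    by blast
qed

end
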